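(* Let $W$ be the Weyl group of type $E_8$ with simple reflections $S=\{s_1,\dots,s_8\}$ and root system $\Phi$, let $I=S\setminus\{s_8\}$ (so $W_I\cong W(E_7)$), and let $U\subseteq\Phi$ be the set of all positive roots of $8$-height $1$. Then $(W,I,U)$ is a QP-triple; that is, $\Omega_U$ is a quasiparabolic $W_I$-set with respect to the level function $\rho_U$.
   Context: $\Phi$ is the root system of type $E_8$ with simple roots $\alpha_1,\dots,\alpha_8$ labelled so that $\alpha_1,\alpha_3,\alpha_4,\alpha_5,\alpha_6,\alpha_7,\alpha_8$ form a path in the Dynkin diagram in this order and $\alpha_2$ is joined only to $\alpha_4$; $B$ is the invariant form with $B(\alpha_i,\alpha_i)=2$, $B(\alpha_i,\alpha_j)=-1$ for adjacent nodes and $0$ otherwise; $s_\alpha(\beta)=\beta-B(\alpha,\beta)\alpha$, $s_i=s_{\alpha_i}$, $W_J=\langle J\rangle$. For a root $\alpha=\sum c_i\alpha_i$, its $i$-height is $c_i$. For a root $\alpha$, $|\alpha|$ is the positive root among $\pm\alpha$; the standard action is $w\cdot R=\{|w(\alpha)|:\alpha\in R\}$ on sets $R$ of pairwise orthogonal positive roots. For $U\subseteq\Phi_+$: $\kappa$ is the maximal size of a pairwise orthogonal subset of $U$, $\Omega_U$ the set of pairwise orthogonal subsets of $U$ of size $\kappa$; $\mathrm{Res}_U(R)=\{\gamma\in U:s_\beta(\gamma)\in\Phi_+\ \forall\beta\in R\}$, $\rho_U(R)=|\mathrm{Res}_U(R)|$. Quasiparabolic sets: for a Coxeter system $(W',S')$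 with reflections $T'$, a scaled $W'$-set is a $W'$-set $X$ with $\lambda:X\to\mathbb Z$ such that $|\lambda(sx)-\lambda(x)|\le1$ for $s\in S'$; it is quasiparabolic if (QP1) $r\in T'$, $\lambda(rx)=\lambda(x)\Rightarrow rx=x$, and (QP2) $r\in T'$, $s\in S'$, $\lambda(rx)>\lambda(x)$ and $\lambda(srx)<\lambda(sx)\Rightarrow rx=sx$. $(W,I,U)$ is a QP-triple if $\Omega_U$ is a quasiparabolic $W_I$-set under the restriction of the standard action with level $\rho_U$. *)

theory Defs
  imports "HOL-Algebra.Elementary_Groups" "HOL-Algebra.Group_Action"
begin

section \<open>Scaled and quasiparabolic sets\<close>

text \<open>
  The three predicates below are meant for a Coxeter system \<open>(G, S)\<close>: a group \<open>G\<close> with its set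
  \<open>S\<close> of Coxeter generators.  The conditions mention only the generators and their
  conjugates, so they are written for an arbitrary pair \<open>(G, S)\<close>.  A \<open>G\<close>-set is given by an
  action map \<open>act\<close> on the set \<open>X\<close> in the sense of \<^locale>\<open>group_action\<close>.
\<close>

definition reflections :: "('g, 'm) monoid_scheme \<Rightarrow> 'g set \<Rightarrow> 'g set" where
  "reflections G S = {w \<otimes>\<^bsub>G\<^esub> s \<otimes>\<^bsub>G\<^esub> inv\<^bsub>G\<^esub> w | w s. w \<in> carrier G \<and> s \<in> S}"

definition scaled_set ::
  "('g, 'm) monoid_scheme \<Rightarrow> 'g set \<Rightarrow> 'x set \<Rightarrow> ('g \<Rightarrow> 'x \<Rightarrow> 'x) \<Rightarrow> ('x \<Rightarrow> int) \<Rightarrow> bool" where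
  "scaled_set G S X act lev \<longleftrightarrow>
     group_action G X act \<and> (\<forall>s\<in>S. \<forall>x\<in>X. \<bar>lev (act s x) - lev x\<bar> \<le> 1)"

definition quasiparabolic ::
  "('g, 'm) monoid_scheme \<Rightarrow> 'g set \<Rightarrow> 'x set \<Rightarrow> ('g \<Rightarrow> 'x \<Rightarrow> 'x) \<Rightarrow> ('x \<Rightarrow> int) \<Rightarrow> bool" where
  "quasiparabolic G S X act lev \<longleftrightarrow>
     scaled_set G S X act lev \<and>
     (\<forall>r\<in>reflections G S. \<forall>x\<in>X. lev (act r x) = lev x \<longrightarrow> act r x = x) \<and>
     (\<forall>r\<in>reflections G S. \<forall>s\<in>S. \<forall>x\<in>X.
        lev (act r x) > lev x \<and> lev (act s (act r x)) < lev (act s x) \<longrightarrow> act r x = act s x)"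


section \<open>The root system of type \<open>E\<^sub>8\<close>\<close>

text \<open>
  A vector \<open>\<Sum>i=1..8. c\<^sub>i \<alpha>\<^sub>i\<close> of the root lattice is encoded by its coefficient function, whose
  value at \<open>i\<close> is \<open>c\<^sub>i\<close>, the \<open>i\<close>-height.  Only the arguments \<open>1, \<dots>, 8\<close> matter: roots vanish at
  all other arguments, the form ignores them, and the reflections leave them fixed.
\<close>

type_synonym vec = "nat \<Rightarrow> int"

definition adjacent :: "nat \<Rightarrow> nat \<Rightarrow> bool" where
  "adjacent i j \<longleftrightarrow> {i, j} \<in> {{1, 3}, {3, 4}, {4, 5}, {5, 6}, {6, 7}, {7, 8}, {2, 4}}"

definition gram :: "nat \<Rightarrow> nat \<Rightarrow> int" where
  "gram i j = (if i = j then 2 else if adjacent i j then - 1 else 0)"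

definition B :: "vec \<Rightarrow> vec \<Rightarrow> int" where
  "B x y = (\<Sum>i\<in>{1..8}. \<Sum>j\<in>{1..8}. x i * y j * gram i j)"

definition simple_root :: "nat \<Rightarrow> vec" where
  "simple_root i = (\<lambda>j. if j = i then 1 else 0)"

definition reflection :: "vec \<Rightarrow> vec \<Rightarrow> vec" where
  "reflection \<alpha> \<beta> = (\<lambda>j. \<beta> j - B \<alpha> \<beta> * \<alpha> j)"

definition simple_refl :: "nat \<Rightarrow> vec \<Rightarrow> vec" where
  "simple_refl i = reflection (simple_root i)"

definition simple_refls :: "(vec \<Rightarrow> vec) set" where
  "simple_refls = simple_refl ` {1..8}"

definition weyl_group :: "(vec \<Rightarrow> vec) monoid" where
  "weyl_group = subgroup_generated (BijGroup UNIV) simple_refls"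

definition roots :: "vec set" where
  "roots = {w (simple_root i) | w i. w \<in> carrier weyl_group \<and> i \<in> {1..8}}"

definition positive_roots :: "vec set" where
  "positive_roots = {\<alpha> \<in> roots. \<forall>i\<in>{1..8}. \<alpha> i \<ge> 0}"

definition height :: "nat \<Rightarrow> vec \<Rightarrow> int" where
  "height i \<alpha> = \<alpha> i"

definition abs_root :: "vec \<Rightarrow> vec" where
  "abs_root \<alpha> = (if \<alpha> \<in> positive_roots then \<alpha> else - \<alpha>)"


section \<open>QP-triples\<close>

definition std_act :: "(vec \<Rightarrow> vec) \<Rightarrow> vec set \<Rightarrow> vec set" where
  "std_act w R = (\<lambda>\<alpha>. abs_root (w \<alpha>)) ` R"

definition orthogonal_set :: "vec set \<Rightarrow> bool" where
  "orthogonal_set R \<longleftrightarrow> pairwise (\<lambda>\<alpha> \<beta>. B \<alpha> \<beta> = 0) R"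

definition kappa :: "vec set \<Rightarrow> nat" where
  "kappa U = Max (card ` {R. R \<subseteq> U \<and> orthogonal_set R})"

definition Omega :: "vec set \<Rightarrow> vec set set" where
  "Omega U = {R. R \<subseteq> U \<and> orthogonal_set R \<and> card R = kappa U}"

definition Res :: "vec set \<Rightarrow> vec set \<Rightarrow> vec set" where
  "Res U R = {\<gamma> \<in> U. \<forall>\<beta>\<in>R. reflection \<beta> \<gamma> \<in> positive_roots}"

definition rho :: "vec set \<Rightarrow> vec set \<Rightarrow> int" where
  "rho U R = int (card (Res U R))"

text \<open>
  \<open>W\<close> is the Weyl group, \<open>I\<close> a set of simple reflections and \<open>U\<close> a set of positive roots.
  The action map is restricted to \<open>Omega U\<close> because \<^locale>\<open>group_action\<close> takes values in
  \<^term>\<open>BijGroup (Omega U)\<close>, whose elements are extensional.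
\<close>

definition QP_triple :: "(vec \<Rightarrow> vec) monoid \<Rightarrow> (vec \<Rightarrow> vec) set \<Rightarrow> vec set \<Rightarrow> bool" where
  "QP_triple W I U \<longleftrightarrow>
     quasiparabolic (subgroup_generated W I) I (Omega U)
       (\<lambda>w. restrict (std_act w) (Omega U)) (rho U)"

end

(*
  Let theta be the highest root; B theta x is the 8-height of x.  The elements of Omega U are the
  orthogonal quadruples x in U, and they have sum 2 theta.  A root p of 8-height 0 therefore has
  products 0, 1, -1 with the elements of x that sum to zero, and its reflection r acts on x in one
  of three ways.
  (1) All products are 0 and r fixes x.
  (2) The products are 1, -1, 0, 0 on a, b, c, d.  Then r replaces a, b by a - p, b + p, as does the
  reflection in q = a - b - p, and the level rises if p and q have the same sign and falls otherwise:
  when p and q are positive, the elements leaving Res inject into the new ones by adding p or q, and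
  a is not in the image.
  (3) The products are 1, 1, -1, -1.  Then p = a + b - theta and r replaces x by theta - x.  The map
  g |-> g + theta - (sum of the b in x with B b g = 1) matches the elements of Res up to one, and the
  level rises or falls by 1 according to the signs of the roots theta - a - b.
  So the direction in which r changes the level depends only on signs of certain roots, whose
  reflections move x as r does.  A simple reflection s changes the sign of no other root than its
  own, so it can reverse the direction only if s x = r x, which is (QP2).
*)
theory Submission
  imports Defs "HOL-Library.Function_Algebras"
begin

section \<open>The form\<close>

lemma interval8: "{1..8::nat} = {1, 2, 3, 4, 5, 6, 7, 8}"
  by auto

lemma gram_commute: "gram i j = gram j i"
  by (simp add: gram_def adjacent_def insert_commute)

lemma B_commute: "B x y = B y x"
  unfolding B_def by (subst sum.swap) (simp add: gram_commute mult.commute mult.left_commute)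

lemma B_add_left: "B (x + y) z = B x z + B y z"
  by (simp add: B_def algebra_simps sum.distrib)

lemma B_diff_left: "B (x - y) z = B x z - B y z"
  by (simp add: B_def algebra_simps sum_subtractf)

lemma B_minus_left: "B (- x) z = - B x z"
  by (simp add: B_def sum_negf)

lemma B_scale_left: "B (\<lambda>j. c * x j) z = c * B x z"
  by (simp add: B_def sum_distrib_left mult.assoc)

lemma B_zero_left: "B 0 z = 0"
  by (simp add: B_def)

lemma B_add_right: "B z (x + y) = B z x + B z y"
  using B_add_left B_commute by metis

lemma B_diff_right: "B z (x - y) = B z x - B z y"
  using B_diff_left B_commute by metis

lemma B_minus_right: "B z (- x) = - B z x"
  using B_minus_left B_commute by metis

lemma B_scale_right: "B z (\<lambda>j. c * x j) = c * B z x"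
  using B_scale_left B_commute by metis

lemma B_zero_right: "B z 0 = 0"
  using B_zero_left B_commute by metis

lemmas B_linear = B_add_left B_add_right B_diff_left B_diff_right B_minus_left B_minus_right
  B_zero_left B_zero_right

lemma B_sum_left: "finite A \<Longrightarrow> B (sum f A) z = (\<Sum>a\<in>A. B (f a) z)"
proof (induction A rule: finite_induct)
  case empty
  show ?case by (simp only: sum.empty B_zero_left)
next
  case (insert x F)
  then show ?case by (simp only: sum.insert[OF insert(1,2)] B_add_left)
qed

lemma B_sum_right: "finite A \<Longrightarrow> B z (sum f A) = (\<Sum>a\<in>A. B z (f a))"
  by (simp only: B_commute[of z] B_sum_left)

lemma B_expand:
  "B x y = 2 * (x 1 * y 1 + x 2 * y 2 + x 3 * y 3 + x 4 * y 4 + x 5 * y 5 + x 6 * y 6 + x 7 * y 7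
      + x 8 * y 8) - (x 1 * y 3 + x 3 * y 1) - (x 3 * y 4 + x 4 * y 3) - (x 4 * y 5 + x 5 * y 4)
      - (x 5 * y 6 + x 6 * y 5) - (x 6 * y 7 + x 7 * y 6) - (x 7 * y 8 + x 8 * y 7)
      - (x 2 * y 4 + x 4 * y 2)"
  unfolding B_def interval8
  by (simp add: gram_def adjacent_def doubleton_eq_iff algebra_simps)

text \<open>Squares are completed along the diagram, eliminating the nodes 1 to 8 in turn; the
  factor 60 clears the denominators. Positive definiteness of the form is read off from this
  identity.\<close>

lemma B_sum_of_squares:
  "60 * B x x = 30 * (2 * x 1 - x 3)\<^sup>2 + 30 * (2 * x 2 - x 4)\<^sup>2 + 10 * (3 * x 3 - 2 * x 4)\<^sup>2
      + 2 * (5 * x 4 - 6 * x 5)\<^sup>2 + 3 * (4 * x 5 - 5 * x 6)\<^sup>2 + 5 * (3 * x 6 - 4 * x 7)\<^sup>2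
      + 10 * (2 * x 7 - 3 * x 8)\<^sup>2 + 30 * (x 8)\<^sup>2"
  by (simp add: B_expand power2_eq_square algebra_simps)

lemma B_nonneg: "0 \<le> B x x"
proof -
  have "0 \<le> 60 * B x x" unfolding B_sum_of_squares by simp
  then show ?thesis by simp
qed

lemma B_even: "even (B x x)"
  by (simp add: B_expand mult.commute)

text \<open>The form ignores coordinates outside the diagram, so it is definite only on vectors that
  vanish there.\<close>

definition supported :: "vec \<Rightarrow> bool" where
  "supported x \<longleftrightarrow> (\<forall>i. i \<notin> {1..8} \<longrightarrow> x i = 0)"

lemma supported_closed:
  "supported x \<Longrightarrow> supported y \<Longrightarrow> supported (x + y)"
  "supported x \<Longrightarrow> supported y \<Longrightarrow> supported (x - y)"
  "supported x \<Longrightarrow> supported (- x)"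
  "supported 0"
  by (simp_all add: supported_def)

lemma B_eq_0_imp:
  assumes "supported x" "B x x = 0"
  shows "x = 0"
proof -
  have "0 = 30 * (2 * x 1 - x 3)\<^sup>2 + 30 * (2 * x 2 - x 4)\<^sup>2 + 10 * (3 * x 3 - 2 * x 4)\<^sup>2
      + 2 * (5 * x 4 - 6 * x 5)\<^sup>2 + 3 * (4 * x 5 - 5 * x 6)\<^sup>2 + 5 * (3 * x 6 - 4 * x 7)\<^sup>2
      + 10 * (2 * x 7 - 3 * x 8)\<^sup>2 + 30 * (x 8)\<^sup>2"
    using B_sum_of_squares[of x] assms(2) by simp
  then have sq: "(2 * x 1 - x 3)\<^sup>2 = 0" "(2 * x 2 - x 4)\<^sup>2 = 0" "(3 * x 3 - 2 * x 4)\<^sup>2 = 0"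
      "(5 * x 4 - 6 * x 5)\<^sup>2 = 0" "(4 * x 5 - 5 * x 6)\<^sup>2 = 0" "(3 * x 6 - 4 * x 7)\<^sup>2 = 0"
      "(2 * x 7 - 3 * x 8)\<^sup>2 = 0" "(x 8)\<^sup>2 = 0"
    using zero_le_power2[of "2 * x 1 - x 3"] zero_le_power2[of "2 * x 2 - x 4"]
      zero_le_power2[of "3 * x 3 - 2 * x 4"] zero_le_power2[of "5 * x 4 - 6 * x 5"]
      zero_le_power2[of "4 * x 5 - 5 * x 6"] zero_le_power2[of "3 * x 6 - 4 * x 7"]
      zero_le_power2[of "2 * x 7 - 3 * x 8"] zero_le_power2[of "x 8"] by linarith+
  \<comment> \<open>The last square gives \<open>x 8 = 0\<close>, and going backwards each of the
    others yields one more coordinate.\<close>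
  then have "x i = 0" if "i \<in> {1..8}" for i
    using that unfolding interval8 by auto
  then show ?thesis
    using assms(1) unfolding supported_def by (auto simp: fun_eq_iff)
qed

section \<open>Roots as vectors of norm two\<close>

text \<open>In the lattice of type E8 the roots are exactly the vectors of norm two. This turns
  membership in a Weyl group orbit into an equation.\<close>

definition norm2 :: "vec set" where
  "norm2 = {x. supported x \<and> B x x = 2}"

lemma norm2D: "x \<in> norm2 \<Longrightarrow> supported x" "x \<in> norm2 \<Longrightarrow> B x x = 2"
  by (simp_all add: norm2_def)

lemma norm2_minus: "x \<in> norm2 \<Longrightarrow> - x \<in> norm2"
  by (simp add: norm2_def supported_closed B_linear)

lemma norm2_diff: "x \<in> norm2 \<Longrightarrow> y \<in> norm2 \<Longrightarrow> B x y = 1 \<Longrightarrow> x - y \<in> norm2"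
  by (simp add: norm2_def supported_closed B_linear B_commute)

lemma norm2_add: "x \<in> norm2 \<Longrightarrow> y \<in> norm2 \<Longrightarrow> B x y = - 1 \<Longrightarrow> x + y \<in> norm2"
  by (simp add: norm2_def supported_closed B_linear B_commute)

text \<open>Both \<open>x - y\<close> and \<open>x + y\<close> have nonnegative norm. In the extreme
  cases one of these norms is zero, whence \<open>norm2_eq\<close> and
  \<open>norm2_eq_minus\<close>.\<close>

lemma norm2_bound:
  assumes "x \<in> norm2" "y \<in> norm2"
  shows "B x y \<le> 2" "- 2 \<le> B x y"
  using B_nonneg[of "x - y"] B_nonneg[of "x + y"] assms
  by (simp_all add: norm2_def B_linear B_commute)

lemma norm2_eq:
  assumes "x \<in> norm2" "y \<in> norm2" "B x y = 2"
  shows "x = y"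
proof -
  have "B (x - y) (x - y) = 0"
    using assms by (simp add: norm2_def B_linear B_commute)
  then show ?thesis
    using B_eq_0_imp[of "x - y"] assms by (simp add: norm2_def supported_closed)
qed

lemma norm2_eq_minus:
  assumes "x \<in> norm2" "y \<in> norm2" "B x y = - 2"
  shows "x = - y"
  using norm2_eq[OF assms(1) norm2_minus[OF assms(2)]] assms(3) by (simp add: B_linear)

text \<open>The positive and the negative part of a vector have non-positive product, so in a vector of
  norm two one of them has norm less than two and hence vanishes.\<close>
lemma norm2_sign:
  assumes "x \<in> norm2"
  shows "0 \<le> x \<or> x \<le> 0"
proof -
  define p where "p = (\<lambda>i. max (x i) 0)"
  define q where "q = (\<lambda>i. max (- x i) 0)"
  have x: "x = p - q" by (auto simp: p_def q_def fun_eq_iff)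
  have sup: "supported p" "supported q"
    using assms by (auto simp: norm2_def supported_def p_def q_def)
  have "B p q = (\<Sum>i\<in>{1..8}. \<Sum>j\<in>{1..8}. p i * q j * gram i j)" by (simp add: B_def)
  also have "\<dots> \<le> 0"
  proof (intro sum_nonpos)
    fix i j
    show "p i * q j * gram i j \<le> 0"
    proof (cases "i = j")
      case True
      then have "p i * q j = 0" by (auto simp: p_def q_def)
      then show ?thesis by (simp only: mult_zero_left)
    next
      case False
      then have "gram i j \<le> 0" by (simp add: gram_def)
      moreover have "0 \<le> p i * q j" by (simp add: p_def q_def)
      ultimately show ?thesis by (rule mult_nonneg_nonpos[rotated])
    qed
  qed
  finally have "B p q \<le> 0" .
  moreover have "B x x = B p p + B q q - 2 * B p q"
    unfolding x by (simp add: B_linear B_commute)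
  ultimately have "B p p + B q q \<le> 2" using norm2D(2)[OF assms] by simp
  then have "B p p < 2 \<or> B q q < 2" by linarith
  then have "B p p = 0 \<or> B q q = 0"
    using B_nonneg[of p] B_nonneg[of q] B_even[of p] B_even[of q] by presburger
  then have "p = 0 \<or> q = 0" using B_eq_0_imp sup by blast
  then show ?thesis
  proof
    assume "p = 0"
    then have "max (x i) 0 = 0" for i unfolding p_def by (metis zero_fun_apply)
    then have "x \<le> 0" unfolding le_fun_def by (metis max.cobounded1 zero_fun_apply)
    then show ?thesis ..
  next
    assume "q = 0"
    then have "max (- x i) 0 = 0" for i unfolding q_def by (metis zero_fun_apply)
    then have "- x i \<le> 0" for i by (metis max.cobounded1)
    then have "0 \<le> x" unfolding le_fun_def by simp
    then show ?thesis ..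
  qed
qed

lemma norm2_nonzero: "x \<in> norm2 \<Longrightarrow> x \<noteq> 0"
  by (auto simp: norm2_def B_linear)

lemma norm2_not_nonneg_iff: "x \<in> norm2 \<Longrightarrow> \<not> 0 \<le> x \<longleftrightarrow> x \<le> 0"
  using norm2_sign norm2_nonzero by (metis order_antisym)

text \<open>The highest root, its coefficients listed in the order of the labels; list positions
  start at 0, hence \<open>i - 1\<close>. It has product 1 with \<open>simple_root 8\<close> and 0
  with the other simple roots, so products with it measure the 8-height.\<close>

definition theta :: vec where
  "theta = (\<lambda>i. if i \<in> {1..8} then [2, 3, 4, 6, 5, 4, 3, 2] ! (i - 1) else 0)"

lemma B_theta: "B x theta = x 8" "B theta x = x 8"
  by (simp_all add: B_expand theta_def)

lemma theta_norm2: "theta \<in> norm2"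
  by (simp add: norm2_def supported_def B_theta) (simp add: theta_def)

lemma theta_8 [simp]: "theta 8 = 2"
  by (simp add: theta_def)

lemma simple_root_norm2: "i \<in> {1..8} \<Longrightarrow> simple_root i \<in> norm2"
  unfolding norm2_def supported_def interval8
  by (auto simp: simple_root_def B_expand)

text \<open>A multiple \<open>c\<close> of a simple root has norm \<open>2 * c * c\<close>, which
  leaves only \<open>c = 1\<close> for a nonnegative vector.\<close>

lemma norm2_simple_root:
  assumes "x \<in> norm2" "0 \<le> x" "i \<in> {1..8}" "\<And>j. j \<noteq> i \<Longrightarrow> x j = 0"
  shows "x = simple_root i"
proof -
  have x: "x = (\<lambda>j. x i * simple_root i j)"
    using assms(4) by (auto simp: simple_root_def fun_eq_iff)
  have "2 = x i * (x i * B (simple_root i) (simple_root i))"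
    using norm2D(2)[OF assms(1)] by (subst (asm) x, subst (asm) (2) x)
      (simp only: B_scale_left B_scale_right)
  then have "x i * x i = 1" using norm2D(2)[OF simple_root_norm2[OF assms(3)]] by simp
  moreover have "0 \<le> x i" using assms(2) by (simp add: le_fun_def)
  ultimately have "x i = 1" by (simp add: zmult_eq_1_iff)
  then have "x j = simple_root i j" for j using fun_cong[OF x, of j] by simp
  then show ?thesis by (rule ext)
qed

section \<open>Reflections and linear isometries\<close>

lemma B_reflection_right: "B y (reflection a x) = B y x - B a x * B y a"
proof -
  have "reflection a x = x - (\<lambda>j. B a x * a j)" by (simp add: reflection_def fun_eq_iff)
  then show ?thesis by (simp add: B_linear B_scale_right)
qed

lemma B_reflection_left: "B (reflection a x) y = B x y - B a x * B a y"
  using B_reflection_right B_commute by metis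

lemma reflection_involution: "a \<in> norm2 \<Longrightarrow> reflection a (reflection a x) = x"
  by (simp add: reflection_def[of a "reflection a x"] B_reflection_right norm2D(2))
    (simp add: reflection_def fun_eq_iff algebra_simps)

lemma reflection_cases:
  "B a x = 0 \<Longrightarrow> reflection a x = x"
  "B a x = 1 \<Longrightarrow> reflection a x = x - a"
  "B a x = - 1 \<Longrightarrow> reflection a x = x + a"
  "B a x = 2 \<Longrightarrow> reflection a x = x - a - a"
  by (simp_all add: reflection_def fun_eq_iff)

lemma reflection_minus: "reflection (- a) = reflection a"
  by (simp add: reflection_def fun_eq_iff B_linear)

text \<open>The last clause keeps the coordinates outside the diagram, so that
  \<open>supported\<close>, and with it \<open>norm2\<close>, is preserved.\<close>

definition lin_isometry :: "(vec \<Rightarrow> vec) \<Rightarrow> bool" where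
  "lin_isometry w \<longleftrightarrow> (\<forall>x y. w (x + y) = w x + w y) \<and> (\<forall>c x. w (\<lambda>j. c * x j) = (\<lambda>j. c * w x j)) \<and>
     (\<forall>x y. B (w x) (w y) = B x y) \<and> (\<forall>x i. i \<notin> {1..8} \<longrightarrow> w x i = x i)"

lemma lin_isometryD:
  assumes "lin_isometry w"
  shows "w (x + y) = w x + w y" "w (\<lambda>j. c * x j) = (\<lambda>j. c * w x j)" "B (w x) (w y) = B x y"
    "w (x - y) = w x - w y" "w (- x) = - w x"
proof -
  show add: "w (x + y) = w x + w y" for x y using assms by (simp add: lin_isometry_def)
  show "w (\<lambda>j. c * x j) = (\<lambda>j. c * w x j)" "B (w x) (w y) = B x y"
    using assms by (simp_all add: lin_isometry_def)
  show diff: "w (x - y) = w x - w y" for x y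
    using add[of "x - y" y] by (simp add: algebra_simps)
  show "w (- x) = - w x"
    using diff[of 0 x] diff[of 0 0] by simp
qed

lemma lin_isometry_norm2: "lin_isometry w \<Longrightarrow> x \<in> norm2 \<Longrightarrow> w x \<in> norm2"
  by (simp add: lin_isometry_def norm2_def supported_def)

lemma lin_isometry_reflection: "a \<in> norm2 \<Longrightarrow> lin_isometry (reflection a)"
  unfolding lin_isometry_def
proof (intro conjI allI impI)
  fix x y :: vec and c :: int and i
  assume a: "a \<in> norm2"
  show "reflection a (x + y) = reflection a x + reflection a y"
    by (simp add: reflection_def fun_eq_iff B_linear algebra_simps)
  show "reflection a (\<lambda>j. c * x j) = (\<lambda>j. c * reflection a x j)"
    by (simp add: reflection_def fun_eq_iff B_scale_right algebra_simps)
  show "B (reflection a x) (reflection a y) = B x y"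
    using norm2D(2)[OF a]
    by (simp add: B_reflection_left B_reflection_right B_commute[of y a] B_commute[of x a])
  show "reflection a x i = x i" if "i \<notin> {1..8}"
    using norm2D(1)[OF a] that by (simp add: reflection_def supported_def)
qed

lemma lin_isometry_comp: "lin_isometry v \<Longrightarrow> lin_isometry w \<Longrightarrow> lin_isometry (v \<circ> w)"
  by (simp add: lin_isometry_def)

lemma lin_isometry_id: "lin_isometry id"
  by (simp add: lin_isometry_def)

lemma lin_isometry_reflection_conj:
  assumes "lin_isometry w"
  shows "w (reflection a x) = reflection (w a) (w x)"
proof -
  have "reflection a x = x - (\<lambda>j. B a x * a j)" by (simp add: reflection_def fun_eq_iff)
  then show ?thesis
    by (simp add: lin_isometryD[OF assms]) (simp add: reflection_def fun_eq_iff lin_isometryD[OF assms])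
qed

section \<open>The Weyl group\<close>

lemma simple_refl_isometry: "i \<in> {1..8} \<Longrightarrow> lin_isometry (simple_refl i)"
  by (simp add: simple_refl_def lin_isometry_reflection simple_root_norm2)

lemma simple_refl_involution: "i \<in> {1..8} \<Longrightarrow> simple_refl i (simple_refl i x) = x"
  by (simp add: simple_refl_def reflection_involution simple_root_norm2)

lemma BijGroup_UNIV:
  "carrier (BijGroup UNIV) = {f. bij f}"
  "f \<in> carrier (BijGroup UNIV) \<Longrightarrow> g \<in> carrier (BijGroup UNIV) \<Longrightarrow> f \<otimes>\<^bsub>BijGroup UNIV\<^esub> g = f \<circ> g"
  "\<one>\<^bsub>BijGroup UNIV\<^esub> = id"
  by (auto simp: BijGroup_def Bij_def compose_def fun_eq_iff)

lemma simple_refls_carrier: "simple_refls \<subseteq> carrier (BijGroup UNIV)"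
proof -
  have "bij (simple_refl i)" if "i \<in> {1..8}" for i
    by (rule o_bij[of "simple_refl i" "simple_refl i"]; rule ext; simp only: comp_apply id_apply simple_refl_involution[OF that])
  then show ?thesis by (auto simp: BijGroup_UNIV simple_refls_def)
qed

lemma inv_simple_refl:
  assumes "i \<in> {1..8}"
  shows "inv\<^bsub>BijGroup UNIV\<^esub> (simple_refl i) = simple_refl i"
proof (rule group.inv_equality[OF group_BijGroup])
  show c: "simple_refl i \<in> carrier (BijGroup UNIV)"
    using simple_refls_carrier assms by (auto simp: simple_refls_def)
  then show "simple_refl i \<in> carrier (BijGroup UNIV)" .
  show "simple_refl i \<otimes>\<^bsub>BijGroup UNIV\<^esub> simple_refl i = \<one>\<^bsub>BijGroup UNIV\<^esub>"
    unfolding BijGroup_UNIV(2)[OF c c] BijGroup_UNIV(3)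
    by (rule ext) (simp only: comp_apply id_apply simple_refl_involution[OF assms])
qed

text \<open>Generating inside the group of all bijections makes the Weyl group and its standard
  parabolic subgroups instances of one construction, with composition as product.\<close>

definition parabolic :: "nat set \<Rightarrow> (vec \<Rightarrow> vec) monoid" where
  "parabolic J = subgroup_generated (BijGroup UNIV) (simple_refl ` J)"

lemma weyl_group_parabolic: "weyl_group = parabolic {1..8}"
  by (simp add: weyl_group_def parabolic_def simple_refls_def)

lemma group_parabolic: "group (parabolic J)"
  unfolding parabolic_def by (rule group.group_subgroup_generated[OF group_BijGroup])

lemma simple_refl_parabolic:
  assumes "J \<subseteq> {1..8}" "i \<in> J"
  shows "simple_refl i \<in> carrier (parabolic J)"
  unfolding parabolic_def carrier_subgroup_generated
  using assms simple_refls_carrier by (intro generate.incl) (auto simp: simple_refls_def)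

lemma parabolic_carrier_subset: "carrier (parabolic J) \<subseteq> carrier (BijGroup UNIV)"
  unfolding parabolic_def by (rule group.carrier_subgroup_generated_subset[OF group_BijGroup])

lemma parabolic_mult:
  "v \<in> carrier (parabolic J) \<Longrightarrow> w \<in> carrier (parabolic J) \<Longrightarrow> v \<otimes>\<^bsub>parabolic J\<^esub> w = v \<circ> w"
  using parabolic_carrier_subset[of J] BijGroup_UNIV(2)[of v w]
  by (auto simp: parabolic_def subgroup_generated_def)

lemma parabolic_one: "\<one>\<^bsub>parabolic J\<^esub> = id"
  by (simp add: parabolic_def BijGroup_UNIV)

lemma parabolic_inv:
  assumes "w \<in> carrier (parabolic J)"
  shows "inv\<^bsub>parabolic J\<^esub> w \<in> carrier (parabolic J)" "w ((inv\<^bsub>parabolic J\<^esub> w) x) = x"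
    "(inv\<^bsub>parabolic J\<^esub> w) (w x) = x"
proof -
  interpret G: group "parabolic J" by (rule group_parabolic)
  show i: "inv\<^bsub>parabolic J\<^esub> w \<in> carrier (parabolic J)" using assms by simp
  show "w ((inv\<^bsub>parabolic J\<^esub> w) x) = x" "(inv\<^bsub>parabolic J\<^esub> w) (w x) = x"
    using G.r_inv[OF assms] G.l_inv[OF assms] assms i
    by (simp_all add: parabolic_mult parabolic_one fun_eq_iff)
qed

text \<open>Generators are involutions, so the inverse case of \<open>generate\<close> reduces to
  the case of a generator.\<close>

lemma parabolic_induct [consumes 2, case_names id refl comp]:
  assumes "w \<in> carrier (parabolic J)" "J \<subseteq> {1..8}"
    and "P id" "\<And>i. i \<in> J \<Longrightarrow> P (simple_refl i)" "\<And>v w. P v \<Longrightarrow> P w \<Longrightarrow> P (v \<circ> w)"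
  shows "P w"
proof -
  let ?G = "BijGroup UNIV :: (vec \<Rightarrow> vec) monoid"
  have "w \<in> generate ?G (carrier ?G \<inter> simple_refl ` J)"
    using assms(1) by (simp add: parabolic_def carrier_subgroup_generated)
  then have "P w \<and> w \<in> carrier ?G"
  proof (induction rule: generate.induct)
    case one
    show ?case
      unfolding BijGroup_UNIV(3) using assms(3) by (simp only: BijGroup_UNIV(1) mem_Collect_eq bij_id)
  next
    case (incl h)
    then show ?case using assms(4) by auto
  next
    case (inv h)
    then obtain i where "i \<in> J" "h = simple_refl i" by auto
    then show ?case using assms(2,4) inv inv_simple_refl[of i] by auto
  next
    case (eng v w)
    then show ?case using assms(5)
      by (metis BijGroup_UNIV(2) group.is_monoid group_BijGroup monoid.m_closed)
  qed
  then show ?thesis ..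
qed

lemma parabolic_isometry:
  assumes "w \<in> carrier (parabolic J)" "J \<subseteq> {1..8}"
  shows "lin_isometry w"
  using assms
proof (induction rule: parabolic_induct)
  case id
  show ?case by (rule lin_isometry_id)
next
  case (refl i)
  then show ?case using simple_refl_isometry assms(2) by blast
next
  case (comp v w)
  then show ?case by (rule lin_isometry_comp)
qed

section \<open>Positive roots as nonnegative vectors of norm two\<close>

lemma roots_subset_norm2: "roots \<subseteq> norm2"
  unfolding roots_def weyl_group_parabolic
  using parabolic_isometry lin_isometry_norm2 simple_root_norm2 by blast

lemma simple_refl_roots:
  assumes "x \<in> roots" "i \<in> {1..8}"
  shows "simple_refl i x \<in> roots"
proof -
  obtain w j where w: "w \<in> carrier weyl_group" "j \<in> {1..8}" "x = w (simple_root j)"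
    using assms(1) by (auto simp: roots_def)
  have s: "simple_refl i \<in> carrier weyl_group"
    unfolding weyl_group_parabolic using assms(2) by (simp add: simple_refl_parabolic)
  have "simple_refl i \<circ> w \<in> carrier weyl_group"
    using s w(1) parabolic_mult[of "simple_refl i" "{1..8}" w]
      group.is_monoid[OF group_parabolic[of "{1..8}"]] monoid.m_closed
    unfolding weyl_group_parabolic by metis
  moreover have "simple_refl i x = (simple_refl i \<circ> w) (simple_root j)" using w(3) by simp
  ultimately show ?thesis unfolding roots_def using w(2) by blast
qed

lemma simple_root_roots: "i \<in> {1..8} \<Longrightarrow> simple_root i \<in> roots"
  unfolding roots_def weyl_group_parabolic mem_Collect_eq
  using monoid.one_closed[OF group.is_monoid[OF group_parabolic[of "{1..8}"]]]
  by (auto simp only: parabolic_one intro!: exI[of _ id] exI[of _ i] id_apply[symmetric])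

lemma B_eq_sum_simple: "B y x = (\<Sum>i\<in>{1..8}. y i * B (simple_root i) x)"
  unfolding interval8 by (simp add: B_expand simple_root_def algebra_simps)

text \<open>Descent on the coefficient sum. As \<open>B x x\<close> is positive, some simple root
  has positive product with \<open>x\<close>. Either \<open>x\<close> equals it, or subtracting it
  leaves a smaller nonnegative vector of norm two, from which \<open>x\<close> is recovered by the
  simple reflection.\<close>

lemma nonneg_norm2_roots:
  assumes "x \<in> norm2" "0 \<le> x"
  shows "x \<in> roots"
  using assms
proof (induction "nat (\<Sum>i\<in>{1..8}. x i)" arbitrary: x rule: less_induct)
  case less
  have "\<exists>i\<in>{1..8}. 0 < B (simple_root i) x"
  proof (rule ccontr)
    assume "\<not> ?thesis"
    then have neg: "B (simple_root i) x \<le> 0" if "i \<in> {1..8}" for i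
      using that by (blast intro: leI)
    have pos: "0 \<le> x i" for i using less(3) by (simp add: le_fun_def)
    have "B x x \<le> 0"
      unfolding B_eq_sum_simple[of x x]
      by (rule sum_nonpos, rule mult_nonneg_nonpos) (rule pos, rule neg)
    then show False using norm2D(2)[OF less(2)] by simp
  qed
  then obtain i where i: "i \<in> {1..8}" "0 < B (simple_root i) x" by auto
  let ?a = "simple_root i"
  have a: "?a \<in> norm2" using simple_root_norm2 i by simp
  show ?case
  proof (cases "B ?a x = 2")
    case True
    then show ?thesis using norm2_eq[OF a less(2)] simple_root_roots[OF i(1)] by simp
  next
    case False
    then have b1: "B ?a x = 1" using i(2) norm2_bound[OF a less(2)] by linarith
    have n: "x - ?a \<in> norm2" using norm2_diff[OF less(2) a] b1 by (simp add: B_commute)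
    have pos: "0 \<le> x - ?a"
    proof (rule ccontr)
      assume "\<not> ?thesis"
      then have "x - ?a \<le> 0" using norm2_not_nonneg_iff[OF n] by simp
      then have le: "x j \<le> ?a j" "0 \<le> x j" for j using less(3) by (auto simp: le_fun_def)
      have "x j = 0" if "j \<noteq> i" for j
        using le[of j] that by (simp add: simple_root_def)
      then have "x = ?a" using norm2_simple_root[OF less(2,3) i(1)] by blast
      then show False using b1 norm2D(2)[OF a] by simp
    qed
    have "(\<Sum>j\<in>{1..8}. (x - ?a) j) = (\<Sum>j\<in>{1..8}. x j) - 1"
      using i(1) by (simp add: sum_subtractf) (simp add: simple_root_def)
    moreover have "0 \<le> (\<Sum>j\<in>{1..8}. (x - ?a) j)"
      using pos by (intro sum_nonneg) (auto simp: le_fun_def)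
    ultimately have "x - ?a \<in> roots"
      using less(1)[OF _ n pos] by linarith
    then have "simple_refl i (x - ?a) \<in> roots" using simple_refl_roots i(1) by blast
    moreover have "simple_refl i (x - ?a) = x"
      unfolding simple_refl_def using reflection_cases(3)[of ?a "x - ?a"] b1 norm2D(2)[OF a]
      by (simp add: B_linear)
    ultimately show ?thesis by simp
  qed
qed

lemma positive_roots_eq: "positive_roots = {x \<in> norm2. 0 \<le> x}"
proof
  show "positive_roots \<subseteq> {x \<in> norm2. 0 \<le> x}"
  proof
    fix x assume x: "x \<in> positive_roots"
    then have n: "x \<in> norm2" using roots_subset_norm2 by (auto simp: positive_roots_def)
    then have "0 \<le> x i" for i
      using x by (cases "i \<in> {1..8}") (auto simp: positive_roots_def norm2_def supported_def)
    then show "x \<in> {x \<in> norm2. 0 \<le> x}" using n by (simp add: le_fun_def)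
  qed
  show "{x \<in> norm2. 0 \<le> x} \<subseteq> positive_roots"
    using nonneg_norm2_roots by (auto simp: positive_roots_def le_fun_def)
qed

text \<open>The reflection changes only the coordinate \<open>i\<close>. If the image were
  nonpositive, all other coordinates of \<open>x\<close> would vanish, making \<open>x\<close> the
  simple root itself.\<close>

lemma simple_refl_nonneg:
  assumes "x \<in> norm2" "0 \<le> x" "i \<in> {1..8}" "x \<noteq> simple_root i"
  shows "0 \<le> simple_refl i x"
proof (rule ccontr)
  assume "\<not> ?thesis"
  moreover have "simple_refl i x \<in> norm2"
    using lin_isometry_norm2[OF simple_refl_isometry] assms by blast
  ultimately have le: "simple_refl i x j \<le> 0" for j
    using norm2_not_nonneg_iff by (auto simp: le_fun_def)
  have "x j = 0" if "j \<noteq> i" for j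
    using le[of j] that assms(2)
    by (simp add: simple_refl_def reflection_def simple_root_def le_fun_def order_antisym)
  then show False using norm2_simple_root assms by blast
qed

lemma simple_refl_sign:
  assumes "x \<in> norm2" "i \<in> {1..8}" "x \<noteq> simple_root i" "x \<noteq> - simple_root i"
  shows "0 \<le> simple_refl i x \<longleftrightarrow> 0 \<le> x"
proof
  assume "0 \<le> x"
  then show "0 \<le> simple_refl i x" using simple_refl_nonneg assms by blast
next
  assume s: "0 \<le> simple_refl i x"
  show "0 \<le> x"
  proof (rule ccontr)
    assume "\<not> 0 \<le> x"
    then have "0 \<le> - x" using norm2_not_nonneg_iff[OF assms(1)] by simp
    moreover have "- x \<noteq> simple_root i" using assms(4) by (metis minus_minus)
    ultimately have "0 \<le> simple_refl i (- x)"
      using simple_refl_nonneg[OF norm2_minus[OF assms(1)]] assms(2) by blast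
    then have "simple_refl i x \<le> 0"
      using lin_isometryD(5)[OF simple_refl_isometry[OF assms(2)]] by simp
    then have "simple_refl i x = 0" using s by (rule order_antisym)
    then show False
      using norm2_nonzero lin_isometry_norm2[OF simple_refl_isometry[OF assms(2)] assms(1)] by blast
  qed
qed

text \<open>By definiteness the products with the simple roots determine a vector, and these
  products lie between -2 and 2.\<close>

lemma finite_norm2: "finite norm2"
proof -
  define f where "f x = restrict (\<lambda>i. B (simple_root i) x) {1..8}" for x
  have "inj_on f norm2"
  proof (rule inj_onI)
    fix x y assume x: "x \<in> norm2" and y: "y \<in> norm2" and eq: "f x = f y"
    have e: "B (simple_root i) (x - y) = 0" if "i \<in> {1..8}" for i
      using fun_cong[OF eq, of i] that unfolding f_def B_diff_right by (simp only: restrict_apply if_True)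
    have "B (x - y) (x - y) = 0"
      unfolding B_eq_sum_simple[of "x - y" "x - y"]
      by (intro sum.neutral ballI) (simp only: e mult_zero_right)
    then show "x = y"
      using B_eq_0_imp[of "x - y"] norm2D(1)[OF x] norm2D(1)[OF y] by (simp add: supported_closed)
  qed
  moreover have "f ` norm2 \<subseteq> {1..8} \<rightarrow>\<^sub>E {- 2..2}"
  proof
    fix g assume "g \<in> f ` norm2"
    then obtain x where x: "x \<in> norm2" "g = f x" by blast
    have "B (simple_root i) x \<in> {- 2..2}" if "i \<in> {1..8}" for i
      using norm2_bound[OF simple_root_norm2[OF that] x(1)] by simp
    then show "g \<in> {1..8} \<rightarrow>\<^sub>E {- 2..2}" unfolding x(2) f_def by (rule restrict_PiE_iff[THEN iffD2, rule_format])
  qed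
  moreover have "finite ({1..8::nat} \<rightarrow>\<^sub>E {- 2..2::int})" by (rule finite_PiE) simp_all
  ultimately show ?thesis using inj_on_finite by blast
qed

section \<open>Roots of 8-height one and zero\<close>

text \<open>Orthogonally to \<open>theta\<close> these project to the 56 weights of the minuscule
  representation of E7, whose root system is \<open>roots0\<close> below.\<close>

definition wts :: "vec set" where
  "wts = {x \<in> norm2. x 8 = 1}"

definition roots0 :: "vec set" where
  "roots0 = {x \<in> norm2. x 8 = 0}"

lemma wtsD: "x \<in> wts \<Longrightarrow> x \<in> norm2" "x \<in> wts \<Longrightarrow> x 8 = 1" "x \<in> wts \<Longrightarrow> B x x = 2"
  by (simp_all add: wts_def norm2_def)

lemma roots0D: "x \<in> roots0 \<Longrightarrow> x \<in> norm2" "x \<in> roots0 \<Longrightarrow> x 8 = 0" "x \<in> roots0 \<Longrightarrow> B x x = 2"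
  by (simp_all add: roots0_def norm2_def)

lemma finite_wts: "finite wts"
  using finite_norm2 by (simp add: wts_def)

lemma norm2_nonneg:
  assumes "x \<in> norm2" "0 < x 8"
  shows "0 \<le> x"
proof (rule ccontr)
  assume "\<not> 0 \<le> x"
  then have "x \<le> 0" using norm2_not_nonneg_iff assms(1) by simp
  then have "x 8 \<le> 0" by (simp add: le_fun_def)
  then show False using assms(2) by simp
qed

lemma wts_positive: "x \<in> wts \<Longrightarrow> x \<in> positive_roots"
  using norm2_nonneg[of x] by (simp add: wts_def positive_roots_eq)

lemma positive_roots_height_one: "{x \<in> positive_roots. height 8 x = 1} = wts"
  using wts_positive by (auto simp: wts_def height_def positive_roots_eq)

text \<open>Product -2 would make the two roots opposite, but both have 8-height 1.\<close>

lemma B_wts: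
  assumes "x \<in> wts" "y \<in> wts"
  shows "B x y = 2 \<longleftrightarrow> x = y" "B x y \<le> 2" "- 1 \<le> B x y"
proof -
  show "B x y = 2 \<longleftrightarrow> x = y" "B x y \<le> 2"
    using assms norm2_eq norm2_bound by (auto simp: wts_def norm2_def)
  have "B x y \<noteq> - 2"
    using norm2_eq_minus[OF wtsD(1)[OF assms(1)] wtsD(1)[OF assms(2)]] wtsD(2)[OF assms(1)] wtsD(2)[OF assms(2)]
    by auto
  then show "- 1 \<le> B x y"
    using norm2_bound(2)[OF wtsD(1)[OF assms(1)] wtsD(1)[OF assms(2)]] by linarith
qed

lemma B_roots0_wts:
  assumes "a \<in> roots0" "x \<in> wts"
  shows "B a x \<le> 1" "- 1 \<le> B a x"
proof -
  have "B a x \<noteq> 2" "B a x \<noteq> - 2"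
    using norm2_eq[OF roots0D(1)[OF assms(1)] wtsD(1)[OF assms(2)]]
      norm2_eq_minus[OF roots0D(1)[OF assms(1)] wtsD(1)[OF assms(2)]]
      roots0D(2)[OF assms(1)] wtsD(2)[OF assms(2)] by auto
  then show "B a x \<le> 1" "- 1 \<le> B a x"
    using norm2_bound[OF roots0D(1)[OF assms(1)] wtsD(1)[OF assms(2)]] by linarith+
qed

lemma wts_diff_roots0: "x \<in> wts \<Longrightarrow> y \<in> wts \<Longrightarrow> B x y = 1 \<Longrightarrow> x - y \<in> roots0"
  using norm2_diff by (simp add: wts_def roots0_def)

lemma wts_minus_root: "x \<in> wts \<Longrightarrow> a \<in> roots0 \<Longrightarrow> B a x = 1 \<Longrightarrow> x - a \<in> wts"
  using norm2_diff B_commute by (simp add: wts_def roots0_def)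

lemma wts_plus_root: "x \<in> wts \<Longrightarrow> a \<in> roots0 \<Longrightarrow> B a x = - 1 \<Longrightarrow> x + a \<in> wts"
  using norm2_add B_commute by (simp add: wts_def roots0_def)

lemma roots0_minus: "a \<in> roots0 \<Longrightarrow> - a \<in> roots0"
  using norm2_minus by (simp add: roots0_def)

lemma theta_minus_wts: "x \<in> wts \<Longrightarrow> theta - x \<in> wts"
  using norm2_diff[OF theta_norm2] by (simp add: wts_def B_theta)

text \<open>The sum has norm two, and its product with \<open>theta\<close> is its 8-height 2, the
  extreme value.\<close>

lemma wts_opposite:
  assumes "x \<in> wts" "y \<in> wts" "B x y = - 1"
  shows "x + y = theta"
proof -
  have "x + y \<in> norm2" using norm2_add assms by (simp add: wts_def)
  moreover have "B (x + y) theta = 2" using assms by (simp add: B_theta wts_def)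
  ultimately show ?thesis using norm2_eq theta_norm2 by blast
qed

definition ok :: "vec \<Rightarrow> vec \<Rightarrow> bool" where
  "ok b g \<longleftrightarrow> B b g \<le> 0 \<or> B b g = 1 \<and> b \<le> g"

text \<open>For products -1, 0, 1, 2 the reflected vector is \<open>theta\<close>, \<open>g\<close>,
  \<open>g - b\<close>, \<open>- b\<close> respectively. Only the third has a sign that is not
  determined by the product.\<close>

lemma reflection_positive_iff_ok:
  assumes "b \<in> wts" "g \<in> wts"
  shows "reflection b g \<in> positive_roots \<longleftrightarrow> ok b g"
proof -
  consider "B b g = - 1" | "B b g = 0" | "B b g = 1" | "B b g = 2"
    using B_wts[OF assms] by linarith
  then show ?thesis
  proof cases
    case 1
    then have "g + b = theta" using wts_opposite assms by (simp add: add.commute)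
    moreover have "theta \<in> positive_roots"
      using theta_norm2 norm2_nonneg[OF theta_norm2] by (simp add: positive_roots_eq)
    ultimately show ?thesis using 1 by (simp add: ok_def reflection_cases)
  next
    case 2
    then show ?thesis using wts_positive assms by (simp add: ok_def reflection_cases)
  next
    case 3
    then have "g - b \<in> norm2" using norm2_diff assms by (simp add: wts_def B_commute)
    then show ?thesis using 3 by (simp add: ok_def reflection_cases positive_roots_eq)
  next
    case 4
    then have "g = b" using B_wts(1)[OF assms] by simp
    then have "reflection b g = - b" using 4 by (simp add: reflection_cases)
    moreover have "\<not> 0 \<le> - b"
      using le_funD[of 0 "- b" 8] wtsD(2)[OF assms(1)] by auto
    ultimately show ?thesis using 4 by (simp add: ok_def positive_roots_eq)
  qed
qed

lemma Res_eq: "R \<subseteq> wts \<Longrightarrow> Res wts R = {g \<in> wts. \<forall>b\<in>R. ok b g}"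
  using reflection_positive_iff_ok by (auto simp: Res_def)

lemma finite_Res: "finite (Res wts R)"
  using finite_wts by (simp add: Res_def)

section \<open>Maximal orthogonal sets\<close>

text \<open>The vector \<open>\<Sum>R - theta - theta\<close> has norm
  \<open>8 - 2 * card R\<close>. Nonnegativity of the norm bounds the cardinality, and definiteness
  gives the sum in the case of equality.\<close>

lemma orthogonal_wts:
  assumes "R \<subseteq> wts" "orthogonal_set R"
  shows "card R \<le> 4" "card R = 4 \<Longrightarrow> \<Sum>R = theta + theta"
proof -
  have fin: "finite R" using assms(1) finite_wts finite_subset by blast
  have B: "B x y = (if x = y then 2 else 0)" if "x \<in> R" "y \<in> R" for x y
    using assms that wtsD(3) by (auto simp: orthogonal_set_def pairwise_def)
  have "B (\<Sum>R) y = 2" if "y \<in> R" for y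
    using fin that by (simp add: B_sum_left[where f = "\<lambda>x. x", OF fin] B sum.delta' cong: sum.cong)
  then have 1: "B (\<Sum>R) (\<Sum>R) = 2 * int (card R)"
    by (simp add: B_sum_right[where f = "\<lambda>x. x", OF fin])
  have "B y theta = 1" if "y \<in> R" for y
    using assms(1) that wtsD(2) by (auto simp: B_theta)
  then have 2: "B (\<Sum>R) theta = int (card R)"
    by (simp add: B_sum_left[where f = "\<lambda>x. x", OF fin])
  let ?v = "\<Sum>R - theta - theta"
  have v: "B ?v ?v = 8 - 2 * int (card R)"
    unfolding B_linear B_commute[of theta "\<Sum>R"] 1 2 norm2D(2)[OF theta_norm2] by simp
  then show "card R \<le> 4" using B_nonneg[of ?v] by linarith
  assume "card R = 4"
  then have "B ?v ?v = 0" using v by simp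
  moreover have "supported (\<Sum>R)"
    using fin assms(1) by (induction R rule: finite_induct) (auto simp: supported_closed wts_def norm2_def)
  then have "supported ?v" by (intro supported_closed norm2D(1)[OF theta_norm2])
  ultimately have "?v = 0" using B_eq_0_imp by blast
  then show "\<Sum>R = theta + theta" by (simp add: algebra_simps)
qed

text \<open>A maximal orthogonal set with an order on its elements, so that case distinctions can
  name them.\<close>

definition frame :: "vec \<Rightarrow> vec \<Rightarrow> vec \<Rightarrow> vec \<Rightarrow> bool" where
  "frame a b c d \<longleftrightarrow> a \<in> wts \<and> b \<in> wts \<and> c \<in> wts \<and> d \<in> wts \<and>
     B a b = 0 \<and> B a c = 0 \<and> B a d = 0 \<and> B b c = 0 \<and> B b d = 0 \<and> B c d = 0"

lemma frameD:
  assumes "frame a b c d"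
  shows "a \<in> wts" "b \<in> wts" "c \<in> wts" "d \<in> wts"
    "B a b = 0" "B a c = 0" "B a d = 0" "B b c = 0" "B b d = 0" "B c d = 0"
    "B b a = 0" "B c a = 0" "B d a = 0" "B c b = 0" "B d b = 0" "B d c = 0"
    "B a a = 2" "B b b = 2" "B c c = 2" "B d d = 2"
  using assms by (simp_all add: frame_def B_commute wtsD(3))

lemma frame_distinct:
  assumes "frame a b c d"
  shows "a \<noteq> b" "a \<noteq> c" "a \<noteq> d" "b \<noteq> c" "b \<noteq> d" "c \<noteq> d"
  using frameD[OF assms] by auto

lemma frame_perm: "frame a b c d \<Longrightarrow> frame b a c d" "frame a b c d \<Longrightarrow> frame a c b d"
  "frame a b c d \<Longrightarrow> frame a d b c"
  by (auto simp: frame_def B_commute)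

lemma frame_card: "frame a b c d \<Longrightarrow> card {a, b, c, d} = 4"
  using frame_distinct[of a b c d] by simp

lemma frame_orthogonal: "frame a b c d \<Longrightarrow> orthogonal_set {a, b, c, d}"
  using frameD[of a b c d] by (auto simp: orthogonal_set_def pairwise_def)

lemma frame_sum:
  assumes "frame a b c d"
  shows "a + b + c + d = theta + theta"
  using orthogonal_wts(2)[OF _ frame_orthogonal[OF assms] frame_card[OF assms]] frame_distinct[OF assms]
    frameD(1-4)[OF assms] by (simp add: add.assoc)

text \<open>Shows that the bound four is attained. The witness starts with
  \<open>simple_root 8\<close>, and its four lists add up to twice the coefficients of
  \<open>theta\<close>, as \<open>frame_sum\<close> demands.\<close>

lemma frame_exists: "\<exists>a b c d. frame a b c d"
proof -
  define v where "v xs = (\<lambda>i. if i \<in> {1..8} then (xs :: int list) ! (i - 1) else 0)" for xs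
  have "frame (v [0, 0, 0, 0, 0, 0, 0, 1]) (v [0, 1, 1, 2, 2, 2, 2, 1])
      (v [2, 2, 3, 4, 3, 2, 2, 1]) (v [2, 3, 4, 6, 5, 4, 2, 1])"
    by (simp add: frame_def wts_def norm2_def supported_def B_expand) (simp add: v_def)
  then show ?thesis by blast
qed

lemma kappa_wts: "kappa wts = 4"
  unfolding kappa_def
proof (rule Max_eqI)
  have "card ` {R. R \<subseteq> wts \<and> orthogonal_set R} \<subseteq> {..4}"
    using orthogonal_wts(1) by auto
  then show "finite (card ` {R. R \<subseteq> wts \<and> orthogonal_set R})"
    using finite_subset by blast
  show "n \<le> 4" if "n \<in> card ` {R. R \<subseteq> wts \<and> orthogonal_set R}" for n
    using that orthogonal_wts(1) by auto
  obtain a b c d where f: "frame a b c d" using frame_exists by blast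
  show "4 \<in> card ` {R. R \<subseteq> wts \<and> orthogonal_set R}"
    using frame_card[OF f] frame_orthogonal[OF f] frameD(1-4)[OF f]
    by (intro image_eqI[of _ _ "{a, b, c, d}"]) auto
qed

lemma Omega_wts: "Omega wts = {R. R \<subseteq> wts \<and> orthogonal_set R \<and> card R = 4}"
  by (simp add: Omega_def kappa_wts)

lemma frame_Omega: "frame a b c d \<Longrightarrow> {a, b, c, d} \<in> Omega wts"
  using frame_card frame_orthogonal frameD(1-4) by (simp add: Omega_wts)

lemma Omega_frame:
  assumes "x \<in> Omega wts" "a \<in> x" "b \<in> x" "a \<noteq> b"
  obtains c d where "x = {a, b, c, d}" "frame a b c d"
proof -
  have fin: "finite x" and c4: "card x = 4"
    using assms(1) card.infinite by (fastforce simp: Omega_wts)+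
  have "card (x - {a, b}) = 2" using fin c4 assms by (simp add: card_Diff_subset)
  then obtain c d where cd: "x - {a, b} = {c, d}" "c \<noteq> d" by (meson card_2_iff)
  then have x: "x = {a, b, c, d}" and "a \<noteq> c" "a \<noteq> d" "b \<noteq> c" "b \<noteq> d" using assms by auto
  then have "frame a b c d"
    using assms cd(2) unfolding Omega_wts frame_def orthogonal_set_def pairwise_def
    by auto
  then show ?thesis using that x by blast
qed

section \<open>How reflections change the level\<close>

text \<open>If \<open>p\<close> and \<open>q\<close> are positive, an element of \<open>Res wts {a, b, c, d}\<close> that is lost on passing to
  \<open>{a - p, b + p, c, d}\<close> is recovered by adding \<open>p\<close> or \<open>q\<close> to it.\<close>
lemma Res_lost:
  assumes f: "frame a b c d" and p: "p \<in> roots0" and q: "q \<in> roots0" and pos: "0 \<le> p" "0 \<le> q"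
    and Bp: "B p a = 1" "B p b = - 1" "B p c = 0" "B p d = 0" and pq: "a - b = p + q"
    and g: "g \<in> Res wts {a, b, c, d}" and lost: "\<not> ok (a - p) g"
  shows "B a g = 0" "B p g = - 1" "g + p \<in> Res wts {a - p, b + p, c, d} - Res wts {a, b, c, d}"
proof -
  note fD = frameD[OF f]
  have sub: "{a, b, c, d} \<subseteq> wts" using fD by simp
  have a': "a - p \<in> wts" using wts_minus_root fD(1) p Bp(1) by blast
  have b': "b + p \<in> wts" using wts_plus_root fD(2) p Bp(2) by blast
  have g': "g \<in> wts" "ok a g" "ok b g" "ok c g" "ok d g"
    using g sub by (auto simp: Res_eq)
  note Bpg = B_roots0_wts[OF p g'(1)] 
  have ag: "B a g \<le> 1" "B a g = 1 \<Longrightarrow> a \<le> g" using g'(2) by (auto simp: ok_def)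
  have bg: "B b g \<le> 1" "B b g = 1 \<Longrightarrow> b \<le> g" using g'(3) by (auto simp: ok_def)
  have *: "1 \<le> B (a - p) g" "B (a - p) g = 1 \<Longrightarrow> \<not> a - p \<le> g"
    using lost by (auto simp: ok_def)
  \<comment> \<open>Since \<open>p\<close> is nonnegative, \<open>a \<le> g\<close> implies
    \<open>a - p \<le> g\<close>. Being lost then leaves only product 2, that is
    \<open>g = a - p\<close>, which contradicts \<open>a \<le> g\<close>.\<close>
  have "B a g \<noteq> 1"
  proof
    assume 1: "B a g = 1"
    then have le: "a \<le> g" using ag by simp
    moreover have "a - p \<le> a" using pos(1) by simp
    ultimately have "a - p \<le> g" by (rule order_trans[rotated])
    then have "B (a - p) g = 2" using * B_wts(2)[OF a' g'(1)] by linarith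
    then have "a - p = g" using B_wts(1)[OF a' g'(1)] by simp
    then have "a = a - p" using le \<open>a - p \<le> a\<close> by (metis order_antisym)
    then show False using Bp roots0D(3)[OF p] by (simp add: B_linear)
  qed
  then show ag0: "B a g = 0" and pg: "B p g = - 1"
    using *(1) ag(1) Bpg by (auto simp: B_linear)
  have nle: "\<not> a - p \<le> g" using *(2) ag0 pg by (simp add: B_linear)
  have gp: "g + p \<in> wts" using wts_plus_root g'(1) p pg by blast
  have pp: "B p p = 2" using roots0D(3)[OF p] .
  have Bp': "B a p = 1" "B b p = - 1" "B c p = 0" "B d p = 0" using Bp by (simp_all add: B_commute)
  have sub': "{a - p, b + p, c, d} \<subseteq> wts" using a' b' fD by simp
  have "ok (a - p) (g + p)" using ag0 pg pp Bp' by (simp add: ok_def B_linear)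
  moreover have "ok (b + p) (g + p)" using g'(3) pg pp Bp' by (simp add: ok_def B_linear)
  moreover have "ok c (g + p)" "ok d (g + p)"
    using g'(4,5) Bp' pos(1) by (auto simp: ok_def B_linear intro: add_increasing2)
  \<comment> \<open>It is \<open>a\<close> that keeps \<open>g + p\<close> out of the old set: their
    product is 1, and \<open>a \<le> g + p\<close> would mean \<open>a - p \<le> g\<close>.\<close>
  moreover have "\<not> ok a (g + p)"
    using ag0 Bp' nle by (simp add: ok_def B_linear diff_le_eq)
  ultimately show "g + p \<in> Res wts {a - p, b + p, c, d} - Res wts {a, b, c, d}"
    using gp by (simp add: Res_eq[OF sub] Res_eq[OF sub'])
qed

lemma add_eq_imp_eq:
  fixes a b u w :: vec
  assumes "a \<le> u" "b \<le> w" "a + b = u + w"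
  shows "a = u"
proof (rule order_antisym[OF assms(1)])
  have "u = a + b - w" using assms(3) by (simp add: algebra_simps)
  also have "\<dots> \<le> a" using assms(2) by (simp add: algebra_simps)
  finally show "u \<le> a" .
qed

lemma rho_less_if_nonneg:
  assumes f: "frame a b c d" and p: "p \<in> roots0" and q: "q \<in> roots0" and pos: "0 \<le> p" "0 \<le> q"
    and Bp: "B p a = 1" "B p b = - 1" "B p c = 0" "B p d = 0" and pq: "a - b = p + q"
  shows "rho wts {a, b, c, d} < rho wts {a - p, b + p, c, d}"
proof -
  note fD = frameD[OF f]
  define x where "x = {a, b, c, d}"
  define y where "y = {a - p, b + p, c, d}"
  have q_eq: "q = a - b - p" using pq by (simp add: algebra_simps)
  have Bq: "B q a = 1" "B q b = - 1" "B q c = 0" "B q d = 0"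
    using Bp fD by (simp_all add: q_eq B_linear)
  have aq: "a - q = b + p" "b + q = a - p" by (simp_all add: q_eq)
  have y2: "y = {a - q, b + q, c, d}" unfolding y_def aq by blast
  have qp: "a - b = q + p" using pq by (simp add: add.commute)
  have Bpq: "B p q = 0" "B q p = 0" using Bp Bq roots0D(3)[OF p] by (simp_all add: q_eq B_linear B_commute)
  note P = Res_lost[OF f p q pos Bp pq, folded x_def y_def]
  note Q = Res_lost[OF f q p pos(2,1) Bq qp, folded x_def y2]
  have sub: "x \<subseteq> wts" using fD by (simp add: x_def)
  have a': "a - p \<in> wts" using wts_minus_root fD(1) p Bp(1) by blast
  have b': "b + p \<in> wts" using wts_plus_root fD(2) p Bp(2) by blast
  have sub': "y \<subseteq> wts" using a' b' fD by (simp add: y_def)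
  define L where "L = Res wts x - Res wts y"
  define G where "G = Res wts y - Res wts x"
  \<comment> \<open>The new elements are \<open>a - p\<close> and \<open>a - q = b + p\<close>. An
    element lost because of the first is shifted by \<open>p\<close>, any other lost element by
    \<open>q\<close>.\<close>
  define h where "h g = (if ok (a - p) g then g + q else g + p)" for g
  have lost: "\<not> ok (a - q) g" if "g \<in> L" "ok (a - p) g" for g
    using that sub sub' unfolding L_def aq by (auto simp: Res_eq x_def y_def)
  have L_Res: "g \<in> Res wts x" if "g \<in> L" for g using that by (simp add: L_def)
  have hG: "h g \<in> G" if "g \<in> L" for g
    using P(3)[OF L_Res[OF that]] Q(3)[OF L_Res[OF that] lost[OF that]] by (auto simp: h_def G_def)
  \<comment> \<open>Each branch of \<open>h\<close> is a translation, so only a collision between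
    branches has to be excluded. It would force \<open>k = theta - (a - p)\<close> and
    \<open>g = theta - (a - q)\<close>. Then \<open>c \<le> k\<close> and \<open>d \<le> g\<close>
    have equal sums on both sides, so \<open>c = k\<close>, although
    \<open>B c k = 1\<close>.\<close>
  have cross: False
    if g: "g \<in> L" "\<not> ok (a - p) g" and k: "k \<in> L" "ok (a - p) k" and eq: "g + p = k + q" for g k
  proof -
    note P' = P(1,2)[OF L_Res[OF g(1)] g(2)] and Q' = Q(1,2)[OF L_Res[OF k(1)] lost[OF k]]
    have gk: "g \<in> wts" "k \<in> wts" "ok d g" "ok c k"
      using L_Res[OF g(1)] L_Res[OF k(1)] sub by (auto simp: Res_eq x_def)
    have "B p (g + p) = B p (k + q)" "B q (g + p) = B q (k + q)" using eq by simp_all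
    then have "B p k = 1" "B q g = 1"
      using P' Q' Bpq roots0D(3)[OF p] roots0D(3)[OF q] by (simp_all add: B_linear)
    then have "B (a - p) k = - 1" "B (a - q) g = - 1" using P' Q' by (simp_all add: B_linear)
    then have "(a - p) + k = theta" "(a - q) + g = theta"
      using wts_opposite a' b' gk unfolding aq by blast+
    then have k_eq: "k = theta - (a - p)" and g_eq: "g = theta - (a - q)" by (auto simp: algebra_simps)
    have "B c k = 1" "B d g = 1"
      using fD Bp Bq by (simp_all add: k_eq g_eq B_linear B_theta wtsD B_commute)
    then have "c \<le> k" "d \<le> g" using gk by (auto simp: ok_def)
    moreover have "c + d = k + g"
      using frame_sum[OF f] pq unfolding k_eq g_eq by (simp add: fun_eq_iff) (smt (verit))
    ultimately have "c = k" by (rule add_eq_imp_eq)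
    then show False using \<open>B c k = 1\<close> fD by simp
  qed
  have "inj_on h L"
  proof (rule inj_onI)
    fix g k assume "g \<in> L" "k \<in> L" "h g = h k"
    then show "g = k" using cross[of g k] cross[of k g] by (auto simp: h_def split: if_splits)
  qed
  moreover have "a \<in> G - h ` L"
  proof -
    have le: "a - p \<le> a" "b + p \<le> a" using pos aq by (metis diff_le_eq le_add_same_cancel1)+
    have "a \<in> Res wts y"
      unfolding Res_eq[OF sub'] using le fD Bp Bpq by (simp add: y_def ok_def B_linear)
    moreover have "a \<notin> Res wts x"
      unfolding Res_eq[OF sub] using fD by (simp add: x_def ok_def)
    \<comment> \<open>Lost elements on which \<open>h\<close> adds \<open>p\<close> or
      \<open>q\<close> are orthogonal to \<open>a\<close>, so every value of \<open>h\<close> has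
      product 1 with \<open>a\<close>, whereas \<open>B a a = 2\<close>.\<close>
    moreover have "h g \<noteq> a" if "g \<in> L" for g
    proof
      assume "h g = a"
      then have "B a (h g) = 2" using fD by simp
      then show False
        using P(1)[OF L_Res[OF that]] Q(1)[OF L_Res[OF that] lost[OF that]] Bp(1) Bq(1)
        by (auto simp: h_def B_linear B_commute split: if_splits)
    qed
    ultimately show ?thesis by (auto simp: G_def)
  qed
  then have "h ` L \<subset> G" using hG by blast
  moreover have fin: "finite G" "finite L" using finite_Res by (simp_all add: G_def L_def)
  ultimately have "card L < card G" by (metis card_image psubset_card_mono)
  moreover have "card (Res wts x) = card (Res wts x \<inter> Res wts y) + card L"
    "card (Res wts y) = card (Res wts x \<inter> Res wts y) + card G"
    unfolding L_def G_def using finite_Res by (metis card_Int_Diff Int_commute)+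
  ultimately show ?thesis unfolding rho_def x_def[symmetric] y_def[symmetric] by simp
qed

section \<open>Flips of maximal orthogonal sets\<close>

definition flip :: "vec set \<Rightarrow> vec set" where
  "flip x = (\<lambda>b. theta - b) ` x"

lemma flip_flip: "flip (flip x) = x"
  by (simp add: flip_def image_image)

lemma flip_frame: "flip {a, b, c, d} = {theta - a, theta - b, theta - c, theta - d}"
  by (simp add: flip_def)

text \<open>The map sending \<open>b\<close> to \<open>theta - b\<close> negates the component
  orthogonal to \<open>theta\<close> and keeps the other, so products within \<open>wts\<close> are
  preserved.\<close>

lemma frame_theta_minus:
  "frame a b c d \<Longrightarrow> frame (theta - a) (theta - b) (theta - c) (theta - d)"
  by (simp add: frame_def theta_minus_wts B_linear B_theta wtsD norm2D(2)[OF theta_norm2])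

lemma Omega_obtain_frame:
  assumes "x \<in> Omega wts"
  obtains a b c d where "x = {a, b, c, d}" "frame a b c d"
proof -
  have "card x = 4" using assms by (simp add: Omega_wts)
  then obtain a b where "a \<in> x" "b \<in> x" "a \<noteq> b"
    by (metis One_nat_def Suc_1 card_le_Suc0_iff_eq card.infinite numeral_le_one_iff not_less_eq_eq
      semiring_norm(69) zero_neq_numeral)
  then show ?thesis using that Omega_frame[OF assms] by metis
qed

lemma flip_Omega: "x \<in> Omega wts \<Longrightarrow> flip x \<in> Omega wts"
  by (metis Omega_obtain_frame flip_frame frame_Omega frame_theta_minus)

text \<open>The map below is injective because the subset of \<open>{a, b, c, d}\<close> having product one with \<open>g\<close>
  becomes the complementary subset for the image of \<open>g\<close>.\<close>
lemma card_Res_diff_flip_le: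
  assumes x: "x \<in> Omega wts"
  shows "card (Res wts x - flip x) \<le> card (Res wts (flip x) - x)"
proof -
  have sub: "x \<subseteq> wts" "flip x \<subseteq> wts" using x flip_Omega by (auto simp: Omega_wts)
  define N where "N g = {b \<in> x. B b g = 1}" for g
  define h where "h g = g + theta - \<Sum>(N g)" for g
  have key: "h g \<in> Res wts (flip x) - x \<and> N g = {b \<in> x. B b (h g) = 0}" if g: "g \<in> Res wts x - flip x" for g
  proof -
    have gD: "g \<in> wts" "\<And>b. b \<in> x \<Longrightarrow> ok b g" "g \<notin> flip x" using g sub by (auto simp: Res_eq)
    \<comment> \<open>Product -1 would put \<open>g = theta - b\<close> into \<open>flip x\<close>,
      and \<open>ok b g\<close> rules out product 2.\<close>
    have B01: "B b g = 0 \<or> B b g = 1" if b: "b \<in> x" for b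
    proof -
      have "b \<in> wts" using b sub by blast
      have "B b g \<noteq> - 1"
      proof
        assume "B b g = - 1"
        then have "b + g = theta" using wts_opposite \<open>b \<in> wts\<close> gD by blast
        then have "g = theta - b" by (metis add_diff_cancel_left')
        then show False using gD(3) b by (simp add: flip_def)
      qed
      then show ?thesis using gD(2)[OF b] B_wts(3)[OF \<open>b \<in> wts\<close> gD(1)] by (auto simp: ok_def)
    qed
    \<comment> \<open>The four products add up to \<open>B (theta + theta) g = 2\<close>, so exactly
      two of them are 1. The six cases below only rename the elements.\<close>
    have "\<exists>a b c d. x = {a, b, c, d} \<and> frame a b c d \<and> B a g = 1 \<and> B b g = 1 \<and> B c g = 0 \<and> B d g = 0"
    proof -
      obtain a b c d where x_eq: "x = {a, b, c, d}" and f: "frame a b c d"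
        using Omega_obtain_frame[OF x] .
      have "B (a + b + c + d) g = 2"
        unfolding frame_sum[OF f] using wtsD(2)[OF gD(1)] by (simp only: B_linear B_theta)
      then have sum: "B a g + B b g + B c g + B d g = 2" by (simp add: B_linear)
      have perms: "frame a b c d" "frame a c b d" "frame a d b c" "frame b c a d" "frame b d a c" "frame c d a b"
        using f by (auto simp: frame_def B_commute)
      have sets: "x = {a, b, c, d}" "x = {a, c, b, d}" "x = {a, d, b, c}" "x = {b, c, a, d}" "x = {b, d, a, c}"
        "x = {c, d, a, b}" unfolding x_eq by blast+
      have "B a g = 0 \<or> B a g = 1" "B b g = 0 \<or> B b g = 1" "B c g = 0 \<or> B c g = 1" "B d g = 0 \<or> B d g = 1"
        using B01 unfolding x_eq by blast+
      then consider "B a g = 1" "B b g = 1" "B c g = 0" "B d g = 0" | "B a g = 1" "B c g = 1" "B b g = 0" "B d g = 0"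
        | "B a g = 1" "B d g = 1" "B b g = 0" "B c g = 0" | "B b g = 1" "B c g = 1" "B a g = 0" "B d g = 0"
        | "B b g = 1" "B d g = 1" "B a g = 0" "B c g = 0" | "B c g = 1" "B d g = 1" "B a g = 0" "B b g = 0"
        using sum by (elim disjE) auto
      then show ?thesis
      proof cases
        case 1
        show ?thesis
          by (rule exI, rule exI, rule exI, rule exI, intro conjI, rule sets(1), rule perms(1)) (fact 1)+
      next
        case 2
        show ?thesis
          by (rule exI, rule exI, rule exI, rule exI, intro conjI, rule sets(2), rule perms(2)) (fact 2)+
      next
        case 3
        show ?thesis
          by (rule exI, rule exI, rule exI, rule exI, intro conjI, rule sets(3), rule perms(3)) (fact 3)+
      next
        case 4
        show ?thesis
          by (rule exI, rule exI, rule exI, rule exI, intro conjI, rule sets(4), rule perms(4)) (fact 4)+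
      next
        case 5
        show ?thesis
          by (rule exI, rule exI, rule exI, rule exI, intro conjI, rule sets(5), rule perms(5)) (fact 5)+
      next
        case 6
        show ?thesis
          by (rule exI, rule exI, rule exI, rule exI, intro conjI, rule sets(6), rule perms(6)) (fact 6)+
      qed
    qed
    then obtain a b c d where x_eq: "x = {a, b, c, d}" and f: "frame a b c d"
      and Bg: "B a g = 1" "B b g = 1" "B c g = 0" "B d g = 0" by blast
    note fD = frameD[OF f]
    have N: "N g = {a, b}" using Bg by (auto simp: N_def x_eq)
    then have h: "h g = g + theta - a - b" using frame_distinct(1)[OF f] by (simp add: h_def algebra_simps)
    have "ok a g" "ok b g" using gD(2) unfolding x_eq by blast+
    then have le: "a \<le> g" "b \<le> g" using Bg by (simp_all add: ok_def)
    have Bgr: "B g a = 1" "B g b = 1" "B g c = 0" "B g d = 0" using Bg by (simp_all add: B_commute)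
    have hB: "B a (h g) = 0" "B b (h g) = 0" "B c (h g) = 1" "B d (h g) = 1"
      using fD Bg by (simp_all add: h B_linear B_theta wtsD)
    have "B (h g) (h g) = 2"
      unfolding h B_linear B_theta using fD Bg Bgr wtsD(2)[of g] wtsD(3)[of g] gD(1)
      by (simp add: wtsD)
    moreover have "supported (h g)"
      unfolding h using norm2D(1) wtsD(1) fD gD(1) theta_norm2 by (intro supported_closed) blast+
    ultimately have hw: "h g \<in> wts"
      using fD gD(1) by (simp add: wts_def norm2_def) (simp add: h)
    \<comment> \<open>With \<open>theta - a\<close> the product is 1, and
      \<open>theta - a \<le> h g\<close> amounts to \<open>b \<le> g\<close>; the roles of
      \<open>a\<close> and \<open>b\<close> are symmetric. With \<open>theta - c\<close> and
      \<open>theta - d\<close> the product is 0.\<close>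
    have "ok (theta - a) (h g)" "ok (theta - b) (h g)" "ok (theta - c) (h g)" "ok (theta - d) (h g)"
      using hB wtsD(2)[OF hw] le by (simp_all add: ok_def B_linear B_theta) (simp_all add: h algebra_simps)
    then have "h g \<in> Res wts (flip x)"
      unfolding Res_eq[OF sub(2)] using hw by (simp add: x_eq flip_frame)
    moreover have "h g \<notin> x" using hB fD unfolding x_eq by auto
    moreover have "N g = {b \<in> x. B b (h g) = 0}" unfolding N using hB by (auto simp: x_eq)
    ultimately show ?thesis by blast
  qed
  have "inj_on h (Res wts x - flip x)"
  proof (rule inj_onI)
    fix g k assume gk: "g \<in> Res wts x - flip x" "k \<in> Res wts x - flip x" and eq: "h g = h k"
    then have "N g = N k" using key by metis
    then show "g = k" using eq by (simp add: h_def)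
  qed
  moreover have "h ` (Res wts x - flip x) \<subseteq> Res wts (flip x) - x" using key by blast
  ultimately show ?thesis using card_inj_on_le finite_Res by blast
qed

text \<open>Join two elements of \<open>x\<close> when their sum is at most \<open>theta\<close>; a
  center is a vertex joined to all others. Its existence decides whether a flip raises or lowers the
  level.\<close>

definition centers :: "vec set \<Rightarrow> vec set" where
  "centers x = {b \<in> x. \<forall>c\<in>x. c \<noteq> b \<longrightarrow> b + c \<le> theta}"

text \<open>The root \<open>theta - b\<close> has product -1 with \<open>b\<close> and 1 with every
  other \<open>c\<close> in \<open>x\<close>, so what remains to be checked is
  \<open>c \<le> theta - b\<close>. These are the elements left out of the injection in
  \<open>card_Res_diff_flip_le\<close>.\<close>

lemma Res_Int_flip:
  assumes x: "x \<in> Omega wts"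
  shows "Res wts x \<inter> flip x = (\<lambda>b. theta - b) ` centers x"
proof -
  have sub: "x \<subseteq> wts" using x by (simp add: Omega_wts)
  have "ok c (theta - b) \<longleftrightarrow> (c \<noteq> b \<longrightarrow> b + c \<le> theta)" if "b \<in> x" "c \<in> x" for b c
  proof -
    have "B c b = (if c = b then 2 else 0)" "c 8 = 1"
      using x that wtsD sub by (auto simp: Omega_wts orthogonal_set_def pairwise_def)
    then show ?thesis by (auto simp: ok_def B_linear B_theta algebra_simps)
  qed
  then show ?thesis
    using theta_minus_wts sub unfolding Res_eq[OF sub] flip_def centers_def by blast
qed

text \<open>Two centers would give \<open>a + c \<le> theta\<close> and
  \<open>b + d \<le> theta\<close>, with equality after adding. Hence \<open>a + c = theta\<close>,
  but orthogonal roots have a sum of norm 4.\<close>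

lemma centers_unique:
  assumes x: "x \<in> Omega wts" and a: "a \<in> centers x" and b: "b \<in> centers x"
  shows "a = b"
proof (rule ccontr)
  assume "a \<noteq> b"
  then obtain c d where x_eq: "x = {a, b, c, d}" and f: "frame a b c d"
    using Omega_frame[OF x, of a b] a b by (auto simp: centers_def)
  have "a + c \<le> theta" "b + d \<le> theta"
    using a b frame_distinct[OF f] by (auto simp: centers_def x_eq)
  moreover have "(a + c) + (b + d) = theta + theta"
    using frame_sum[OF f] by (simp add: algebra_simps)
  ultimately have "a + c = theta" by (rule add_eq_imp_eq)
  then have "B (a + c) (a + c) = 2" using norm2D(2)[OF theta_norm2] by simp
  then show False using frameD[OF f] by (simp add: B_linear)
qed

text \<open>The vector \<open>theta - a - b\<close> has norm two, so exactly one of its two possible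
  signs occurs.\<close>

lemma wts_orthogonal_le_iff:
  assumes "a \<in> wts" "b \<in> wts" "B a b = 0"
  shows "theta \<le> a + b \<longleftrightarrow> \<not> a + b \<le> theta"
proof -
  have "theta - a - b \<in> norm2"
    using norm2_diff[OF wtsD(1)[OF theta_minus_wts[OF assms(1)]] wtsD(1)[OF assms(2)]] assms
    by (simp add: B_linear B_theta wtsD)
  from norm2_not_nonneg_iff[OF this] show ?thesis by (simp add: algebra_simps)
qed

text \<open>The pairs with sum at most \<open>theta\<close> form a graph on the four elements of \<open>x\<close> containing exactly
  one edge of each of the three perfect matchings, that is, a star or a triangle; flipping turns it
  into the complementary graph.\<close>
lemma centers_flip:
  assumes x: "x \<in> Omega wts"
  shows "centers (flip x) = {} \<longleftrightarrow> centers x \<noteq> {}"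
proof -
  obtain a b c d where x_eq: "x = {a, b, c, d}" and f: "frame a b c d"
    using Omega_obtain_frame[OF x] .
  note fD = frameD[OF f] and di = frame_distinct[OF f]
  have flip_le: "theta - u + (theta - v) \<le> theta \<longleftrightarrow> theta \<le> u + v" for u v
  proof -
    have "theta - u + (theta - v) = theta - (u + v - theta)" by simp
    then show ?thesis by (simp only: diff_le_eq le_add_same_cancel1 diff_ge_0_iff_ge)
  qed
  have theta2_le: "theta + theta - w \<le> theta \<longleftrightarrow> theta \<le> w" for w
    unfolding diff_le_eq by (rule add_le_cancel_left)
  have eqs: "c + d = theta + theta - (a + b)" "b + d = theta + theta - (a + c)" "b + c = theta + theta - (a + d)"
    using frame_sum[OF f] by (simp_all only: eq_diff_eq) (simp_all add: add_ac)
  have compl: "c + d \<le> theta \<longleftrightarrow> \<not> a + b \<le> theta" "b + d \<le> theta \<longleftrightarrow> \<not> a + c \<le> theta"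
      "b + c \<le> theta \<longleftrightarrow> \<not> a + d \<le> theta"
    unfolding eqs theta2_le using wts_orthogonal_le_iff fD by simp_all
  note ge = wts_orthogonal_le_iff[OF fD(1,2,5)] wts_orthogonal_le_iff[OF fD(1,3,6)]
    wts_orthogonal_le_iff[OF fD(1,4,7)] wts_orthogonal_le_iff[OF fD(2,3,8)]
    wts_orthogonal_le_iff[OF fD(2,4,9)] wts_orthogonal_le_iff[OF fD(3,4,10)]
  have "centers x \<noteq> {} \<longleftrightarrow> (\<exists>u\<in>x. \<forall>v\<in>x. v \<noteq> u \<longrightarrow> u + v \<le> theta)"
    by (auto simp: centers_def)
  moreover have "centers (flip x) \<noteq> {} \<longleftrightarrow> (\<exists>u\<in>x. \<forall>v\<in>x. v \<noteq> u \<longrightarrow> theta \<le> u + v)"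
  proof -
    have "centers (flip x) \<noteq> {} \<longleftrightarrow> (\<exists>u\<in>x. \<forall>v\<in>x. theta - v \<noteq> theta - u \<longrightarrow> theta - u + (theta - v) \<le> theta)"
      unfolding centers_def flip_def by blast
    then show ?thesis unfolding flip_le by simp
  qed
  ultimately show ?thesis
    unfolding x_eq using di by (simp add: add.commute[of b a] add.commute[of c a] add.commute[of d a]
      add.commute[of c b] add.commute[of d b] add.commute[of d c] ge compl di[symmetric]) blast
qed

text \<open>The injection applied to \<open>x\<close> and to \<open>flip x\<close> matches the two
  sets outside their overlaps with \<open>flip x\<close> and \<open>x\<close>. By uniqueness and
  \<open>centers_flip\<close>, one overlap is a singleton and the other is empty.\<close>

lemma rho_flip:
  assumes x: "x \<in> Omega wts"
  shows "rho wts (flip x) = rho wts x + (if centers x = {} then 1 else - 1)"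
proof -
  have card_centers: "card (Res wts x \<inter> flip x) = (if centers x = {} then 0 else 1)"
    if x: "x \<in> Omega wts" for x
  proof (cases "centers x = {}")
    case False
    then obtain b where "centers x = {b}" using centers_unique[OF x] by blast
    then show ?thesis by (simp add: Res_Int_flip[OF x])
  qed (simp add: Res_Int_flip[OF x])
  have "card (Res wts x - flip x) = card (Res wts (flip x) - x)"
    using card_Res_diff_flip_le[OF x] card_Res_diff_flip_le[OF flip_Omega[OF x]] by (simp add: flip_flip)
  moreover have "card (Res wts x) = card (Res wts x \<inter> flip x) + card (Res wts x - flip x)"
    "card (Res wts (flip x)) = card (Res wts (flip x) \<inter> x) + card (Res wts (flip x) - x)"
    using finite_Res by (metis card_Int_Diff)+
  ultimately show ?thesis
    using card_centers[OF x] card_centers[OF flip_Omega[OF x]] centers_flip[OF x]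
    by (auto simp: rho_def flip_flip)
qed

section \<open>Isometries preserving the 8-height\<close>

text \<open>The properties of elements of \<open>W_I\<close> on which the argument rests;
  reflections in arbitrary elements of \<open>roots0\<close> share them.\<close>

definition height_isometry :: "(vec \<Rightarrow> vec) \<Rightarrow> bool" where
  "height_isometry w \<longleftrightarrow> lin_isometry w \<and> (\<forall>x. w x 8 = x 8)"

lemma height_isometryD:
  assumes "height_isometry w"
  shows "lin_isometry w" "w x 8 = x 8" "B (w x) (w y) = B x y"
  using assms lin_isometryD(3) by (auto simp: height_isometry_def)

lemma height_isometry_wts: "height_isometry w \<Longrightarrow> x \<in> wts \<Longrightarrow> w x \<in> wts"
  using lin_isometry_norm2 by (simp add: height_isometry_def wts_def)

lemma height_isometry_roots0: "height_isometry w \<Longrightarrow> x \<in> roots0 \<Longrightarrow> w x \<in> roots0"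
  using lin_isometry_norm2 by (simp add: height_isometry_def roots0_def)

text \<open>The image has norm two and 8-height 2, hence product 2 with
  \<open>theta\<close>.\<close>

lemma height_isometry_theta:
  assumes "height_isometry w"
  shows "w theta = theta"
  using norm2_eq[of "w theta" theta] lin_isometry_norm2[of w theta] theta_norm2
    height_isometryD(1,2)[OF assms] by (simp add: B_theta)

lemma height_isometry_inj:
  assumes "height_isometry w"
  shows "inj_on w wts"
proof (rule inj_onI)
  fix x y assume xy: "x \<in> wts" "y \<in> wts" "w x = w y"
  then have "B x y = B (w x) (w x)" using height_isometryD(3)[OF assms, of x y] by simp
  then show "x = y"
    using B_wts(1)[OF xy(1,2)] wtsD(3)[OF xy(1)] height_isometryD(3)[OF assms] by simp
qed

lemma height_isometry_Omega:
  assumes "height_isometry w" "x \<in> Omega wts"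
  shows "w ` x \<in> Omega wts"
proof -
  have x: "x \<subseteq> wts" "orthogonal_set x" "card x = 4" using assms(2) by (simp_all add: Omega_wts)
  have "card (w ` x) = 4"
    using x(1,3) height_isometry_inj[OF assms(1)] by (metis card_image inj_on_subset)
  moreover have "orthogonal_set (w ` x)"
    using x(2) height_isometryD(3)[OF assms(1)] by (auto simp: orthogonal_set_def pairwise_def)
  ultimately show ?thesis using x(1) height_isometry_wts[OF assms(1)] by (auto simp: Omega_wts)
qed

lemma height_isometry_flip:
  assumes "height_isometry w"
  shows "w ` flip x = flip (w ` x)"
  by (simp add: flip_def image_image lin_isometryD(4)[OF height_isometryD(1)[OF assms]]
      height_isometry_theta[OF assms])

lemma height_isometry_frame:
  "height_isometry w \<Longrightarrow> frame a b c d \<Longrightarrow> frame (w a) (w b) (w c) (w d)"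
  by (simp add: frame_def height_isometry_wts height_isometryD(3))

lemma height_isometry_reflection:
  assumes "p \<in> roots0"
  shows "height_isometry (reflection p)"
  using lin_isometry_reflection[OF roots0D(1)[OF assms]] roots0D(2)[OF assms]
  by (simp add: height_isometry_def reflection_def)

lemma height_isometry_image_reflection:
  assumes "height_isometry w"
  shows "w ` reflection p ` x = reflection (w p) ` w ` x"
  by (simp add: image_image lin_isometry_reflection_conj[OF height_isometryD(1)[OF assms]])

lemma simple_root_roots0: "i \<in> {1..7} \<Longrightarrow> simple_root i \<in> roots0"
  using simple_root_norm2 by (auto simp: roots0_def) (simp add: simple_root_def)

lemma parabolic_height_isometry:
  assumes "w \<in> carrier (parabolic {1..7})"
  shows "height_isometry w"
proof -
  have "({1..7} :: nat set) \<subseteq> {1..8}" by auto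
  with assms show ?thesis
  proof (induction rule: parabolic_induct)
    case id
    show ?case using lin_isometry_id by (simp add: height_isometry_def id_def)
  next
    case (refl i)
    then show ?case
      using height_isometry_reflection simple_root_roots0 by (simp add: simple_refl_def)
  next
    case (comp v w)
    then show ?case using lin_isometry_comp[of v w] by (simp add: height_isometry_def comp_def)
  qed
qed

section \<open>Reflections acting on frames\<close>

lemma reflection_frame_exchange:
  assumes "B p a = 1" "B p b = - 1" "B p c = 0" "B p d = 0"
  shows "reflection p ` {a, b, c, d} = {a - p, b + p, c, d}"
  using assms by (simp add: reflection_cases)

text \<open>Adding the root to \<open>a\<close> gives \<open>theta - b\<close> and vice versa. The
  pair \<open>c\<close>, \<open>d\<close> behaves alike because \<open>theta - c - d\<close> is the
  negative of the same root.\<close>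

lemma reflection_frame_flip:
  assumes "frame a b c d"
  shows "reflection (theta - a - b) ` {a, b, c, d} = flip {a, b, c, d}"
proof -
  note fD = frameD[OF assms]
  have B: "B (theta - a - b) a = - 1" "B (theta - a - b) b = - 1"
      "B (theta - a - b) c = 1" "B (theta - a - b) d = 1"
    using fD by (simp_all add: B_linear B_theta wtsD)
  have "c + d = theta + theta - a - b"
    using frame_sum[OF assms] by (simp only: eq_diff_eq) (simp add: add_ac)
  then have "c - (theta - a - b) = theta - d" "d - (theta - a - b) = theta - c"
    by (simp_all add: algebra_simps)
  then have "reflection (theta - a - b) a = theta - b" "reflection (theta - a - b) b = theta - a"
      "reflection (theta - a - b) c = theta - d" "reflection (theta - a - b) d = theta - c"
    using B by (simp_all add: reflection_cases)
  then show ?thesis by (auto simp: flip_frame)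
qed

lemma reflection_Omega_cases:
  assumes x: "x \<in> Omega wts" and p: "p \<in> roots0"
  obtains (fixed) "reflection p ` x = x"
  | (exchange) a b c d where "x = {a, b, c, d}" "frame a b c d"
      "B p a = 1" "B p b = - 1" "B p c = 0" "B p d = 0"
  | (flip) "reflection p ` x = flip x"
proof -
  have sum0: "B p a + B p b + B p c + B p d = 0" if "frame a b c d" for a b c d
  proof -
    have "B p (a + b + c + d) = 0"
      unfolding frame_sum[OF that] B_add_right B_theta using roots0D(2)[OF p] by simp
    then show ?thesis by (simp add: B_linear)
  qed
  have bd: "B p b \<le> 1" "- 1 \<le> B p b" if "b \<in> wts" for b
    using B_roots0_wts[OF p that] .
  \<comment> \<open>Two products equal to 1 determine \<open>p\<close>: its product with the root
    \<open>theta - a - b\<close> is then the extreme value -2.\<close>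
  have pair_flip: "reflection p ` x = flip x"
    if x_eq: "x = {a, b, c, d}" and f: "frame a b c d" and Bp: "B p a = 1" "B p b = 1" for a b c d
  proof -
    have "theta - a - b \<in> norm2"
      using norm2_diff[OF wtsD(1)[OF theta_minus_wts] wtsD(1), of a b] frameD[OF f]
      by (simp add: B_linear B_theta wtsD)
    moreover have "B p (theta - a - b) = - 2"
      using Bp roots0D(2)[OF p] by (simp add: B_linear B_theta)
    ultimately have "p = - (theta - a - b)" using norm2_eq_minus[OF roots0D(1)[OF p]] by blast
    then show ?thesis
      unfolding x_eq using reflection_frame_flip[OF f] reflection_minus by metis
  qed
  show ?thesis
  proof (cases "\<forall>b\<in>x. B p b = 0")
    case True
    then have "reflection p ` x = x" by (simp add: reflection_cases)
    then show ?thesis by (rule fixed)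
  next
    case False
    obtain a b c d where x_eq: "x = {a, b, c, d}" and f: "frame a b c d"
      using Omega_obtain_frame[OF x] .
    have "\<exists>u\<in>x. B p u = 1" "\<exists>u\<in>x. B p u = - 1"
      using False bd[OF frameD(1)[OF f]] bd[OF frameD(2)[OF f]] bd[OF frameD(3)[OF f]]
        bd[OF frameD(4)[OF f]] sum0[OF f] unfolding x_eq ball_simps bex_simps
      by auto
    then obtain u v where uv: "u \<in> x" "v \<in> x" "B p u = 1" "B p v = - 1" by blast
    then have "u \<noteq> v" by auto
    then obtain y z where x': "x = {u, v, y, z}" and f': "frame u v y z"
      using Omega_frame[OF x uv(1,2)] by metis
    have "B p y + B p z = 0" using sum0[OF f'] uv by simp
    then consider "B p y = 0" "B p z = 0" | "B p y = 1" | "B p z = 1"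
      using bd[OF frameD(3)[OF f']] bd[OF frameD(4)[OF f']] by linarith
    then show ?thesis
    proof cases
      case 1
      then show ?thesis using exchange x' f' uv by blast
    next
      case 2
      have "x = {u, y, v, z}" using x' by blast
      then show ?thesis using flip pair_flip frame_perm(2)[OF f'] uv(3) 2 by blast
    next
      case 3
      have "x = {u, z, v, y}" using x' by blast
      then show ?thesis using flip pair_flip frame_perm(3)[OF f'] uv(3) 3 by blast
    qed
  qed
qed

text \<open>All sign patterns reduce to \<open>rho_less_if_nonneg\<close>: swapping \<open>a\<close>
  and \<open>b\<close> negates both \<open>p\<close> and \<open>q\<close>, while exchanging source
  and target of the move negates just one of them.\<close>

lemma rho_exchange:
  assumes f: "frame a b c d" and p: "p \<in> roots0"
    and Bp: "B p a = 1" "B p b = - 1" "B p c = 0" "B p d = 0"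
  shows "a - b - p \<in> roots0"
    "rho wts {a, b, c, d} < rho wts {a - p, b + p, c, d} \<longleftrightarrow> (0 \<le> p \<longleftrightarrow> 0 \<le> a - b - p)"
    "rho wts {a - p, b + p, c, d} \<noteq> rho wts {a, b, c, d}"
proof -
  note fD = frameD[OF f]
  have a': "a - p \<in> wts" using wts_minus_root fD(1) p Bp(1) by blast
  have b': "b + p \<in> wts" using wts_plus_root fD(2) p Bp(2) by blast
  have "B (a - p) b = 1" using fD Bp by (simp add: B_linear)
  then have "a - p - b \<in> roots0" using wts_diff_roots0[OF a' fD(2)] by blast
  then show q: "a - b - p \<in> roots0" by (simp add: diff_right_commute)
  define q where "q = a - b - p"
  have q0: "q \<in> roots0" using q by (simp add: q_def)
  have pp: "B p p = 2" using roots0D(3)[OF p] .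
  have Bp': "B a p = 1" "B b p = - 1" "B c p = 0" "B d p = 0" using Bp by (simp_all add: B_commute)
  have Bq: "B q a = 1" "B q b = - 1" "B q c = 0" "B q d = 0"
    using Bp fD by (simp_all add: q_def B_linear)
  have f': "frame (a - p) (b + p) c d"
    using a' b' fD Bp Bp' pp by (simp add: frame_def B_linear)
  have sgn: "0 \<le> - u \<longleftrightarrow> \<not> 0 \<le> u" if "u \<in> roots0" for u
    using norm2_not_nonneg_iff[OF roots0D(1)[OF that]] by simp
  have swap: "{b, a, c, d} = {a, b, c, d}" "{b + p, a - p, c, d} = {a - p, b + p, c, d}"
    by blast+
  have neg: "- p \<in> roots0" "- q \<in> roots0" using roots0_minus p q0 by blast+
  have up: "rho wts {a, b, c, d} < rho wts {a - p, b + p, c, d}" if pq: "0 \<le> p \<longleftrightarrow> 0 \<le> q"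
  proof (cases "0 \<le> p")
    case True
    have "a - b = p + q" by (simp add: q_def)
    from rho_less_if_nonneg[OF f p q0 True iffD1[OF pq True] Bp this] show ?thesis .
  next
    case False
    have pos: "0 \<le> - p" "0 \<le> - q" using False pq sgn[OF p] sgn[OF q0] by blast+
    have "B (- p) b = 1" "B (- p) a = - 1" "B (- p) c = 0" "B (- p) d = 0" "b - a = - p + - q"
      using Bp by (simp_all add: B_minus_left q_def)
    from rho_less_if_nonneg[OF frame_perm(1)[OF f] neg pos this] show ?thesis
      unfolding swap diff_minus_eq_add add_uminus_conv_diff .
  qed
  have down: "rho wts {a - p, b + p, c, d} < rho wts {a, b, c, d}" if pq: "\<not> (0 \<le> p \<longleftrightarrow> 0 \<le> q)"
  proof (cases "0 \<le> p")
    case True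
    have pos: "0 \<le> - q" using True pq sgn[OF q0] by blast
    have "B p (b + p) = 1" "B p (a - p) = - 1" "b + p - (a - p) = p + - q"
      using Bp pp by (simp_all add: B_linear q_def)
    from rho_less_if_nonneg[OF frame_perm(1)[OF f'] p neg(2) True pos this(1,2) Bp(3,4) this(3)]
    show ?thesis by (simp add: insert_commute)
  next
    case False
    have pos: "0 \<le> - p" "0 \<le> q" using False pq sgn[OF p] by blast+
    have "B (- p) (a - p) = 1" "B (- p) (b + p) = - 1" "B (- p) c = 0" "B (- p) d = 0"
        "a - p - (b + p) = - p + q"
      using Bp pp by (simp_all add: B_linear q_def)
    from rho_less_if_nonneg[OF f' neg(1) q0 pos this] show ?thesis by simp
  qed
  show "rho wts {a, b, c, d} < rho wts {a - p, b + p, c, d} \<longleftrightarrow> (0 \<le> p \<longleftrightarrow> 0 \<le> a - b - p)"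
    "rho wts {a - p, b + p, c, d} \<noteq> rho wts {a, b, c, d}"
    using up down unfolding q_def by (metis less_asym, metis less_irrefl)
qed

section \<open>The axioms of a quasiparabolic set\<close>

text \<open>A reflection \<open>s\<close> in a simple root \<open>\<alpha>\<close> changes the sign of \<open>\<plusminus>\<alpha>\<close> only, so an element of the left
  hand side that is not in \<open>s ` Res wts x\<close> must satisfy \<open>reflection (s b) g = \<alpha>\<close> for some
  \<open>b \<in> x\<close>, and this forces \<open>g = b\<close>.\<close>
lemma Res_simple_refl_subset:
  assumes x: "x \<in> Omega wts" and i: "i \<in> {1..7}"
  shows "Res wts (simple_refl i ` x) \<subseteq> simple_refl i ` Res wts x \<union> {b \<in> x. B (simple_root i) b = 1}"
proof
  fix g assume g: "g \<in> Res wts (simple_refl i ` x)"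
  define a where "a = simple_root i"
  define s where "s = simple_refl i"
  have s_def': "s = reflection a" by (simp add: s_def a_def simple_refl_def)
  have i8: "i \<in> {1..8}" using i by simp
  have a: "a \<in> roots0" using simple_root_roots0[OF i] by (simp add: a_def)
  have s: "height_isometry s" using height_isometry_reflection[OF a] by (simp add: s_def')
  have ss: "s (s y) = y" for y using simple_refl_involution[OF i8] by (simp add: s_def)
  have xw: "x \<subseteq> wts" using x by (simp add: Omega_wts)
  have gw: "g \<in> wts" and gpos: "\<And>b. b \<in> x \<Longrightarrow> reflection (s b) g \<in> positive_roots"
    using g by (auto simp: Res_def s_def)
  show "g \<in> simple_refl i ` Res wts x \<union> {b \<in> x. B (simple_root i) b = 1}"
  proof (cases "s g \<in> Res wts x")
    case True
    then have "s (s g) \<in> s ` Res wts x" by (rule imageI)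
    then show ?thesis by (simp add: ss) (simp add: s_def)
  next
    case False
    then obtain b where b: "b \<in> x" "reflection b (s g) \<notin> positive_roots"
      using height_isometry_wts[OF s gw] by (auto simp: Res_def)
    define u where "u = reflection (s b) g"
    have u: "u \<in> norm2" "0 \<le> u" using gpos[OF b(1)] by (simp_all add: u_def positive_roots_eq)
    have bw: "b \<in> wts" using b(1) xw by blast
    have "s u = reflection b (s g)"
      unfolding u_def lin_isometry_reflection_conj[OF height_isometryD(1)[OF s]] ss ..
    moreover have "s u \<in> norm2" using lin_isometry_norm2[OF height_isometryD(1)[OF s] u(1)] .
    ultimately have "\<not> 0 \<le> s u" using b(2) by (simp add: positive_roots_eq)
    then have ua: "u = a" using simple_refl_nonneg[OF u i8] by (auto simp: a_def s_def)
    \<comment> \<open>Comparing 8-heights in \<open>u = a\<close> yields the product, hence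
      \<open>g = a + s b\<close>.\<close>
    have "u 8 = 1 - B (s b) g"
      using wtsD(2)[OF gw] wtsD(2)[OF height_isometry_wts[OF s bw]] by (simp add: u_def reflection_def)
    then have Bsg: "B (s b) g = 1" using ua roots0D(2)[OF a] by simp
    then have g_eq: "g = a + s b" using ua by (simp add: u_def reflection_cases(2) algebra_simps)
    have sbb: "B (s b) (s b) = 2" using height_isometryD(3)[OF s] wtsD(3)[OF bw] by simp
    have "B (s b) a = - 1" using Bsg sbb unfolding g_eq B_add_right by simp
    then have "B a b = 1" using roots0D(3)[OF a] by (simp add: s_def' B_reflection_left B_commute[of b a])
    moreover from this have "g = b" by (simp add: g_eq s_def' reflection_cases(2))
    ultimately show ?thesis using b(1) by (simp add: a_def)
  qed
qed

lemma rho_simple_refl_le: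
  assumes "x \<in> Omega wts" "i \<in> {1..7}" and one: "{b \<in> x. B (simple_root i) b = 1} = {c}"
  shows "rho wts (simple_refl i ` x) \<le> rho wts x + 1"
proof -
  have "card (Res wts (simple_refl i ` x)) \<le> card (simple_refl i ` Res wts x \<union> {c})"
    using Res_simple_refl_subset[OF assms(1,2)] finite_Res unfolding one by (intro card_mono) simp_all
  also have "\<dots> \<le> card (simple_refl i ` Res wts x) + 1"
    using card_Un_le[of "simple_refl i ` Res wts x" "{c}"] by simp
  also have "\<dots> \<le> card (Res wts x) + 1" using card_image_le[OF finite_Res] by simp
  finally show ?thesis by (simp add: rho_def)
qed

text \<open>In the exchange case only one element of \<open>x\<close> has product 1 with the simple
  root, so the level rises by at most 1. The same bound at \<open>simple_refl i\<close> applied to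
  \<open>x\<close> covers the opposite direction, the reflection being an involution.\<close>

lemma rho_simple_refl:
  assumes x: "x \<in> Omega wts" and i: "i \<in> {1..7}"
  shows "\<bar>rho wts (simple_refl i ` x) - rho wts x\<bar> \<le> 1"
proof -
  let ?a = "simple_root i"
  let ?s = "simple_refl i"
  have a: "?a \<in> roots0" using simple_root_roots0[OF i] .
  have s: "?s = reflection ?a" by (simp add: simple_refl_def)
  have hs: "height_isometry ?s" unfolding s using height_isometry_reflection[OF a] .
  have ss: "?s (?s y) = y" for y using simple_refl_involution i by simp
  from x a show ?thesis
  proof (cases rule: reflection_Omega_cases)
    case fixed
    then show ?thesis by (simp add: s)
  next
    case (exchange u v c d)
    have "{b \<in> x. B ?a b = 1} = {u}" using exchange by auto
    then have 1: "rho wts (?s ` x) \<le> rho wts x + 1" using rho_simple_refl_le[OF x i] by blast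
    have neg: "B ?a (?s y) = - B ?a y" for y
      using roots0D(3)[OF a] by (simp add: s B_reflection_right)
    have "{b \<in> ?s ` x. B ?a b = 1} = ?s ` {b \<in> x. B ?a b = - 1}"
      by (auto simp: neg)
    also have "{b \<in> x. B ?a b = - 1} = {v}" using exchange by auto
    finally have "{b \<in> ?s ` x. B ?a b = 1} = {?s v}" by simp
    from rho_simple_refl_le[OF height_isometry_Omega[OF hs x] i this]
    have "rho wts x \<le> rho wts (?s ` x) + 1" by (simp add: image_image ss)
    with 1 show ?thesis by linarith
  next
    case flip
    then show ?thesis using rho_flip[OF x] by (simp add: s)
  qed
qed

lemma rho_reflection_eq:
  assumes x: "x \<in> Omega wts" and p: "p \<in> roots0" and eq: "rho wts (reflection p ` x) = rho wts x"
  shows "reflection p ` x = x"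
  using x p
proof (cases rule: reflection_Omega_cases)
  case (exchange a b c d)
  then show ?thesis
    using rho_exchange(3)[OF exchange(2) p exchange(3-6)] eq reflection_frame_exchange[OF exchange(3-6)]
    by simp
next
  case flip
  then show ?thesis using rho_flip[OF x] eq by (simp split: if_splits)
qed

text \<open>If the image of \<open>u\<close> becomes a center, some \<open>c\<close> had
  \<open>u + c\<close> not below \<open>theta\<close>. The root \<open>theta - u - c\<close> then
  changes sign, so it is the simple root up to sign, and its reflection flips
  \<open>x\<close>.\<close>

lemma centers_simple_refl:
  assumes x: "x \<in> Omega wts" and i: "i \<in> {1..7}"
    and "centers x = {}" "centers (simple_refl i ` x) \<noteq> {}"
  shows "simple_refl i ` x = flip x"
proof -
  let ?a = "simple_root i"
  let ?s = "simple_refl i"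
  have i8: "i \<in> {1..8}" using i by simp
  have a: "?a \<in> roots0" using simple_root_roots0[OF i] .
  have s: "?s = reflection ?a" by (simp add: simple_refl_def)
  have hs: "height_isometry ?s" unfolding s using height_isometry_reflection[OF a] .
  have ss: "?s (?s y) = y" for y using simple_refl_involution[OF i8] .
  obtain u where u: "u \<in> x" "\<And>c. c \<in> x \<Longrightarrow> ?s c \<noteq> ?s u \<Longrightarrow> ?s u + ?s c \<le> theta"
    using assms(4) by (auto simp: centers_def)
  have "u \<notin> centers x" using assms(3) by simp
  then obtain c where c: "c \<in> x" "c \<noteq> u" "\<not> u + c \<le> theta" using u(1) by (auto simp: centers_def)
  have "?s c \<noteq> ?s u" using c(2) ss by metis
  then have le: "?s u + ?s c \<le> theta" using u(2)[OF c(1)] by blast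
  obtain d e where x_eq: "x = {u, c, d, e}" and f: "frame u c d e"
    using Omega_frame[OF x u(1) c(1)] c(2) by metis
  let ?t = "theta - u - c"
  have t: "?t \<in> norm2"
    using norm2_diff[OF wtsD(1)[OF theta_minus_wts] wtsD(1), of u c] frameD[OF f]
    by (simp add: B_linear B_theta wtsD)
  have "\<not> 0 \<le> ?t" using c(3) by (simp add: algebra_simps)
  moreover have "?s ?t = theta - (?s u + ?s c)"
    unfolding lin_isometryD(4)[OF height_isometryD(1)[OF hs]] height_isometry_theta[OF hs]
    by (rule diff_diff_eq)
  then have "0 \<le> ?s ?t" using le by (simp only: diff_ge_0_iff_ge)
  ultimately have "?t = ?a \<or> ?t = - ?a" using simple_refl_sign[OF t i8] by blast
  then have "?s = reflection ?t" using s reflection_minus by metis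
  then show ?thesis using reflection_frame_flip[OF f] by (simp add: x_eq)
qed

lemma reflection_eq_simple_refl:
  assumes x: "x \<in> Omega wts" and p: "p \<in> roots0" and i: "i \<in> {1..7}"
    and up: "rho wts x < rho wts (reflection p ` x)"
    and down: "rho wts (simple_refl i ` reflection p ` x) < rho wts (simple_refl i ` x)"
  shows "reflection p ` x = simple_refl i ` x"
proof -
  let ?a = "simple_root i"
  let ?s = "simple_refl i"
  have i8: "i \<in> {1..8}" using i by simp
  have s: "?s = reflection ?a" by (simp add: simple_refl_def)
  have hs: "height_isometry ?s" unfolding s using height_isometry_reflection[OF simple_root_roots0[OF i]] .
  note lin = lin_isometryD[OF height_isometryD(1)[OF hs]]
  from x p show ?thesis
  proof (cases rule: reflection_Omega_cases)
    case fixed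
    then show ?thesis using up by simp
  next
    case (exchange a b c d)
    note f = exchange(2) and Bp = exchange(3-6)
    define q where "q = a - b - p"
    have q: "q \<in> roots0" unfolding q_def using rho_exchange(1)[OF f p Bp] .
    have rx: "reflection p ` x = {a - p, b + p, c, d}"
      unfolding exchange(1) using reflection_frame_exchange[OF Bp] .
    have same: "0 \<le> p \<longleftrightarrow> 0 \<le> q"
      using up[unfolded rx] rho_exchange(2)[OF f p Bp] unfolding exchange(1) q_def by blast
    have sBp: "B (?s p) (?s a) = 1" "B (?s p) (?s b) = - 1" "B (?s p) (?s c) = 0" "B (?s p) (?s d) = 0"
      using Bp by (simp_all add: lin(3))
    have sx: "?s ` x = {?s a, ?s b, ?s c, ?s d}" unfolding exchange(1) by simp
    have srx: "?s ` reflection p ` x = {?s a - ?s p, ?s b + ?s p, ?s c, ?s d}"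
      unfolding height_isometry_image_reflection[OF hs] sx using reflection_frame_exchange[OF sBp] .
    have sq: "?s a - ?s b - ?s p = ?s q" by (simp add: q_def lin(4))
    \<comment> \<open>The signs of \<open>p\<close> and \<open>q\<close> agree before applying
      \<open>?s\<close> and disagree afterwards, so one of the two roots is the simple root up to
      sign.\<close>
    have "\<not> (0 \<le> ?s p \<longleftrightarrow> 0 \<le> ?s q)"
      using rho_exchange(2)[OF height_isometry_frame[OF hs f] height_isometry_roots0[OF hs p] sBp] down
      unfolding srx sx sq by linarith
    then have "p = ?a \<or> p = - ?a \<or> q = ?a \<or> q = - ?a"
      using same simple_refl_sign[OF roots0D(1)[OF p] i8] simple_refl_sign[OF roots0D(1)[OF q] i8]
      by blast
    then have "reflection p = ?s \<or> reflection q = ?s" using s reflection_minus by metis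
    \<comment> \<open>Here \<open>a - q = b + p\<close> and \<open>b + q = a - p\<close>, so
      \<open>p\<close> and \<open>q\<close> move \<open>x\<close> to the same set.\<close>
    moreover have "reflection q ` x = reflection p ` x"
    proof -
      have "B q a = 1" "B q b = - 1" "B q c = 0" "B q d = 0"
        using Bp frameD[OF f] by (simp_all add: q_def B_linear)
      from reflection_frame_exchange[OF this] have "reflection q ` x = {a - q, b + q, c, d}"
        unfolding exchange(1) .
      then show ?thesis unfolding rx by (simp add: q_def insert_commute)
    qed
    ultimately show ?thesis by metis
  next
    case flip
    \<comment> \<open>Since \<open>?s\<close> commutes with flips, the two inequalities say that
      \<open>x\<close> has no center while its image under \<open>?s\<close> has one.\<close>
    have "centers x = {}" using up rho_flip[OF x] unfolding flip by (simp split: if_splits)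
    moreover have "centers (?s ` x) \<noteq> {}"
      using down rho_flip[OF height_isometry_Omega[OF hs x]]
      unfolding flip height_isometry_flip[OF hs] by (simp split: if_splits)
    ultimately show ?thesis using centers_simple_refl[OF x i] flip by simp
  qed
qed

section \<open>The group action and the assembly of the QP-triple\<close>

lemma std_act_image:
  assumes "height_isometry w" "R \<subseteq> wts"
  shows "std_act w R = w ` R"
  unfolding std_act_def
proof (rule image_cong[OF refl])
  \<comment> \<open>Roots of 8-height 1 are positive and \<open>w\<close> keeps that height, so
    \<open>abs_root\<close> changes no sign here.\<close>
  fix b assume "b \<in> R"
  then show "abs_root (w b) = w b"
    using assms(2) wts_positive height_isometry_wts[OF assms(1)] by (auto simp: abs_root_def)
qed

lemma group_action_Omega:
  "group_action (parabolic {1..7}) (Omega wts) (\<lambda>w. restrict (std_act w) (Omega wts))"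
proof -
  let ?G = "parabolic {1..7}"
  let ?X = "Omega wts"
  let ?f = "\<lambda>w. restrict (std_act w) ?X"
  interpret G: group ?G by (rule group_parabolic)
  have act: "?f w x = w ` x" if "w \<in> carrier ?G" "x \<in> ?X" for w x
    using that std_act_image[OF parabolic_height_isometry] by (simp add: Omega_wts)
  have closed: "w ` x \<in> ?X" if "w \<in> carrier ?G" "x \<in> ?X" for w x
    using height_isometry_Omega[OF parabolic_height_isometry] that by blast
  have bij: "?f w \<in> Bij ?X" if w: "w \<in> carrier ?G" for w
  proof -
    note w' = parabolic_inv[OF w]
    let ?w' = "inv\<^bsub>?G\<^esub> w"
    have inv: "?f ?w' (?f w x) = x" "?f w (?f ?w' x) = x" "?f w x \<in> ?X" "?f ?w' x \<in> ?X"
      if x: "x \<in> ?X" for x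
      unfolding act[OF w x] act[OF w'(1) x] act[OF w'(1) closed[OF w x]] act[OF w closed[OF w'(1) x]]
        image_image w'(2,3)
      using closed[OF w x] closed[OF w'(1) x] by simp_all
    have "bij_betw (?f w) ?X ?X"
    proof (rule bij_betw_byWitness)
      show "\<forall>x\<in>?X. ?f ?w' (?f w x) = x" by (rule ballI) (rule inv(1))
      show "\<forall>x\<in>?X. ?f w (?f ?w' x) = x" by (rule ballI) (rule inv(2))
      show "?f w ` ?X \<subseteq> ?X" by (rule image_subsetI) (rule inv(3))
      show "?f ?w' ` ?X \<subseteq> ?X" by (rule image_subsetI) (rule inv(4))
    qed
    then show ?thesis by (simp add: Bij_def)
  qed
  have "?f (v \<otimes>\<^bsub>?G\<^esub> w) = ?f v \<otimes>\<^bsub>BijGroup ?X\<^esub> ?f w" if v: "v \<in> carrier ?G" and w: "w \<in> carrier ?G" for v w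
  proof
    fix x
    show "?f (v \<otimes>\<^bsub>?G\<^esub> w) x = (?f v \<otimes>\<^bsub>BijGroup ?X\<^esub> ?f w) x"
    proof (cases "x \<in> ?X")
      case True
      have "?f (v \<otimes>\<^bsub>?G\<^esub> w) x = v ` w ` x"
        using act[OF G.m_closed[OF v w] True] unfolding parabolic_mult[OF v w] by (simp only: image_comp)
      also have "\<dots> = ?f v (?f w x)"
        unfolding act[OF w True] using act[OF v closed[OF w True]] by simp
      also have "\<dots> = (?f v \<otimes>\<^bsub>BijGroup ?X\<^esub> ?f w) x"
        using bij[OF v] bij[OF w] True by (simp add: BijGroup_def compose_def)
      finally show ?thesis .
    next
      case False
      then show ?thesis using bij[OF v] bij[OF w] by (simp add: BijGroup_def compose_def)
    qed
  qed
  then have "?f \<in> hom ?G (BijGroup ?X)" using bij by (intro homI) (auto simp: BijGroup_def)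
  then show ?thesis
    by (simp add: group_action_def group_hom_def group_hom_axioms_def group_parabolic group_BijGroup)
qed

text \<open>Conjugating a simple reflection by \<open>w\<close> gives the reflection in the image of
  the simple root under \<open>w\<close>, again of 8-height 0.\<close>

lemma reflections_parabolic:
  assumes "r \<in> reflections (parabolic {1..7}) (simple_refl ` {1..7})"
  obtains p where "p \<in> roots0" "r = reflection p"
proof -
  let ?G = "parabolic {1..7}"
  interpret G: group ?G by (rule group_parabolic)
  obtain w i where w: "w \<in> carrier ?G" and i: "i \<in> {1..7}"
    and r: "r = w \<otimes>\<^bsub>?G\<^esub> simple_refl i \<otimes>\<^bsub>?G\<^esub> inv\<^bsub>?G\<^esub> w"
    using assms by (auto simp: reflections_def)
  have s: "simple_refl i \<in> carrier ?G" using i by (intro simple_refl_parabolic) auto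
  note hw = parabolic_height_isometry[OF w]
  have "r = w \<circ> simple_refl i \<circ> inv\<^bsub>?G\<^esub> w"
    unfolding r using parabolic_mult[OF w s] parabolic_mult[OF G.m_closed[OF w s] parabolic_inv(1)[OF w]]
    by simp
  then have "r y = reflection (w (simple_root i)) y" for y
    by (simp only: comp_apply simple_refl_def lin_isometry_reflection_conj[OF height_isometryD(1)[OF hw]]
        parabolic_inv(2)[OF w])
  then have "r = reflection (w (simple_root i))" by (rule ext)
  then show ?thesis using that height_isometry_roots0[OF hw simple_root_roots0[OF i]] by blast
qed

lemma quasiparabolic_Omega:
  "quasiparabolic (parabolic {1..7}) (simple_refl ` {1..7}) (Omega wts)
    (\<lambda>w. restrict (std_act w) (Omega wts)) (rho wts)"
proof -
  have act: "restrict (std_act (reflection p)) (Omega wts) x = reflection p ` x"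
    if "p \<in> roots0" "x \<in> Omega wts" for p x
    using that std_act_image[OF height_isometry_reflection] by (simp add: Omega_wts)
  have s: "restrict (std_act (simple_refl i)) (Omega wts) x = simple_refl i ` x"
    if "i \<in> {1..7}" "x \<in> Omega wts" for i x
    unfolding simple_refl_def using act simple_root_roots0 that by blast
  note O = height_isometry_Omega[OF height_isometry_reflection]
  show ?thesis
    unfolding quasiparabolic_def scaled_set_def
  proof (intro conjI ballI impI; (elim conjE)?)
    show "group_action (parabolic {1..7}) (Omega wts) (\<lambda>w. restrict (std_act w) (Omega wts))"
      by (rule group_action_Omega)
  next
    fix t x assume "t \<in> simple_refl ` {1..7}" "x \<in> Omega wts"
    then show "\<bar>rho wts (restrict (std_act t) (Omega wts) x) - rho wts x\<bar> \<le> 1"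
      using rho_simple_refl s by auto
  next
    fix r x assume "r \<in> reflections (parabolic {1..7}) (simple_refl ` {1..7})" and x: "x \<in> Omega wts"
      and eq: "rho wts (restrict (std_act r) (Omega wts) x) = rho wts x"
    then obtain p where p: "p \<in> roots0" "r = reflection p" using reflections_parabolic by metis
    show "restrict (std_act r) (Omega wts) x = x"
      using rho_reflection_eq[OF x p(1)] eq act[OF p(1) x] p(2) by simp
  next
    fix r t x assume "r \<in> reflections (parabolic {1..7}) (simple_refl ` {1..7})" and x: "x \<in> Omega wts"
      and "t \<in> simple_refl ` {1..7}" and up: "rho wts x < rho wts (restrict (std_act r) (Omega wts) x)"
      and down: "rho wts (restrict (std_act t) (Omega wts) (restrict (std_act r) (Omega wts) x))
        < rho wts (restrict (std_act t) (Omega wts) x)"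
    then obtain p i where p: "p \<in> roots0" "r = reflection p" and i: "i \<in> {1..7}" "t = simple_refl i"
      using reflections_parabolic by (metis imageE)
    show "restrict (std_act r) (Omega wts) x = restrict (std_act t) (Omega wts) x"
      using reflection_eq_simple_refl[OF x p(1) i(1)] up down
      unfolding p(2) i(2) act[OF p(1) x] s[OF i(1) x] s[OF i(1) O[OF p(1) x]] by blast
  qed
qed

text \<open>Deleting the map \<open>simple_refl 8\<close> must delete no other index. The maps are
  told apart at \<open>theta\<close>, whose 8-height is changed by \<open>simple_refl 8\<close>
  alone.\<close>

lemma simple_refls_diff: "simple_refls - {simple_refl 8} = simple_refl ` {1..7}"
proof -
  have "simple_refl i \<noteq> simple_refl 8" if "i \<in> {1..7}" for i
  proof
    assume "simple_refl i = simple_refl 8"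
    then have "simple_refl i theta 8 = simple_refl 8 theta 8" by simp
    then show False using that
      by (simp add: simple_refl_def reflection_def B_theta) (simp add: simple_root_def)
  qed
  moreover have "{1..8} = insert 8 {1..7::nat}" by auto
  ultimately show ?thesis unfolding simple_refls_def by auto
qed

text \<open>\<open>QP_triple\<close> generates inside the Weyl group and \<open>parabolic\<close>
  inside all bijections; the generated subgroup is the same in both.\<close>

lemma subgroup_generated_weyl_group:
  assumes "J \<subseteq> {1..8}"
  shows "subgroup_generated weyl_group (simple_refl ` J) = parabolic J"
proof -
  let ?G = "BijGroup UNIV :: (vec \<Rightarrow> vec) monoid"
  interpret G: group ?G by (rule group_BijGroup)
  have J: "simple_refl ` J \<subseteq> carrier weyl_group"
    using simple_refl_parabolic assms unfolding weyl_group_parabolic by blast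
  have H: "subgroup (carrier weyl_group) ?G"
    unfolding weyl_group_def by (rule G.subgroup_subgroup_generated)
  have wg: "weyl_group = ?G\<lparr>carrier := carrier weyl_group\<rparr>"
    by (simp add: weyl_group_def subgroup_generated_def)
  have "generate weyl_group (simple_refl ` J) = generate ?G (simple_refl ` J)"
    using G.generate_consistent[OF J H] wg by simp
  moreover have "carrier ?G \<inter> simple_refl ` J = simple_refl ` J"
    using J subgroup.subset[OF H] by blast
  ultimately show ?thesis
    using J by (simp add: parabolic_def subgroup_generated_def[of _ "simple_refl ` J"] Int_absorb1)
      (simp add: weyl_group_def subgroup_generated_def)
qed

theorem theorem5p9:
  fixes I :: "(vec \<Rightarrow> vec) set" and U :: "vec set"
  assumes "I = simple_refls - {simple_refl 8}"
    and "U = {\<alpha> \<in> positive_roots. height 8 \<alpha> = 1}"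
  shows "QP_triple weyl_group I U"
proof -
  have I: "I = simple_refl ` {1..7}" using assms(1) simple_refls_diff by simp
  have U: "U = wts" using assms(2) positive_roots_height_one by simp
  have "subgroup_generated weyl_group I = parabolic {1..7}"
    unfolding I by (rule subgroup_generated_weyl_group) auto
  then show ?thesis
    unfolding QP_triple_def using quasiparabolic_Omega by (simp add: I U)
qed

end
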